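(* Let $0<\beta<1$, let $X$ be the one-dimensional super-Brownian motion with $(1+\beta)$-stable branching mechanism started from $\delta_0$ (law $\mathbb P_{\delta_0}$), and let $(L^x)_{x\in\mathbb R}$ be its total local time. Then, under $\mathbb P_{\delta_0}$, the random variable $L^0$ has a positive stable distribution of index $2/(2+\beta)$.
   Context: Fix $0<\beta<1$. $M_F$ is the space of finite measures on $\mathbb R$ with the weak topology, and $\mu(f)=\int f\,d\mu$. The super-Brownian motion $X=(X_t)_{t\ge0}$ with $(1+\beta)$-stable branching started from $X_0\in M_F$ (law $\mathbb P_{X_0}$, expectation $\mathbb E_{X_0}$) is the $M_F$-valued (càdlàg) strong Markov process with $$\mathbb E_{X_0}\Big[\exp\Big\{-X_t(\phi)-\int_0^tX_s(f)\,ds\Big\}\Big]=\exp\{-X_0(V_t)\}$$ for nonnegative bounded Borel $\phi,f$, where $V_t$ is the unique nonnegative solution of $V_t=P_t\phi+\int_0^tP_s(f-V_{t-s}^{1+\beta})\,ds$ (the mild form of $\partial_tV=\frac12\Delta V-V^{1+\beta}+f$, $V_0=\phi$), and $(P_t)$ is the Brownian semigroup (generator $\frac12\Delta$). The occupation measure $\int_0^tX_s(\cdot)\,ds$ has a density $L_t^x$, the local time, i.e. $\int_0^tX_s(\phi)\,ds=\int_{\mathbb R}\phi(x)L_t^x\,dx$ for all nonnegative measurable $\phi$; one uses its jointly continuous version in $(t,x)$. The extinction time $\zeta=\inf\{t\ge0:X_t(1)=0\}$ is a.s. finite, and the total local time is $L^x=L^x_\infty=L^x_\zeta$. A positive stable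 distribution of index $\alpha\in(0,1)$ is a law on $[0,\infty)$ with Laplace transform $\lambda\mapsto e^{-c\lambda^\alpha}$ for some constant $c>0$. *)

theory Defs
  imports "HOL-Probability.Probability"
begin

section \<open>Finite measures on the line\<close>

definition finite_measures :: "real measure set" where
  "finite_measures = {\<mu>. finite_measure \<mu> \<and> sets \<mu> = sets borel}"

text \<open>The weak topology: the coarsest one making \<open>\<mu> \<mapsto> \<mu>(f)\<close> continuous for all bounded
  continuous \<open>f\<close>.\<close>

definition weak_topology :: "real measure topology" where
  "weak_topology = topology_generated_by
     {{\<mu> \<in> finite_measures. (\<integral>x. f x \<partial>\<mu>) \<in> U} | f U.
        continuous_on UNIV (f :: real \<Rightarrow> real) \<and> bounded (range f) \<and> open (U :: real set)}"

definition borel_finite_measures :: "real measure measure" where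
  "borel_finite_measures = sigma finite_measures {U. openin weak_topology U}"

definition cadlag :: "(real \<Rightarrow> real measure) \<Rightarrow> bool" where
  "cadlag w \<longleftrightarrow>
     (\<forall>t\<ge>0. limitin weak_topology w (w t) (at_right t)) \<and>
     (\<forall>t>0. \<exists>l. limitin weak_topology w l (at_left t))"


section \<open>The log-Laplace equation\<close>

text \<open>The semigroup with generator \<open>\<Delta>/2\<close>; \<open>normal_density\<close> takes the standard deviation,
  and its value at standard deviation 0 is not a point mass.\<close>

definition heat_semigroup :: "real \<Rightarrow> (real \<Rightarrow> real) \<Rightarrow> real \<Rightarrow> real" where
  "heat_semigroup t g x =
     (if t = 0 then g x else \<integral>y. normal_density x (sqrt t) y * g y \<partial>lborel)"

definition bounded_nonneg_borel :: "(real \<Rightarrow> real) \<Rightarrow> bool" where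
  "bounded_nonneg_borel f \<longleftrightarrow>
     f \<in> borel_measurable borel \<and> bounded (range f) \<and> (\<forall>x. 0 \<le> f x)"

text \<open>Nonnegative solutions of
  \<open>V\<^sub>t = P\<^sub>t \<phi> + \<integral>\<^sub>0\<^sup>t P\<^sub>s (f - V\<^sub>t\<^sub>-\<^sub>s\<^sup>1\<^sup>+\<^sup>\<beta>) ds\<close>.
  Boundedness on finite time intervals costs nothing, as the equation forces
  \<open>0 \<le> V\<^sub>t \<le> sup \<phi> + t sup f\<close>; it only ensures that every integral below is a genuine one.
  By Gronwall's lemma the values of \<open>V\<close> at times \<open>t \<ge> 0\<close> are then unique.\<close>

definition mild_solution ::
  "real \<Rightarrow> (real \<Rightarrow> real) \<Rightarrow> (real \<Rightarrow> real) \<Rightarrow> (real \<Rightarrow> real \<Rightarrow> real) \<Rightarrow> bool" where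
  "mild_solution \<beta> \<phi> f V \<longleftrightarrow>
     (\<lambda>(t, x). V t x) \<in> borel_measurable (restrict_space borel ({0..} \<times> UNIV)) \<and>
     (\<forall>t\<ge>0. \<forall>x. 0 \<le> V t x) \<and>
     (\<forall>T\<ge>0. \<exists>C. \<forall>t\<in>{0..T}. \<forall>x. V t x \<le> C) \<and>
     (\<forall>t\<ge>0. \<forall>x. V t x = heat_semigroup t \<phi> x +
        (LBINT s:{0..t}. heat_semigroup s (\<lambda>y. f y - V (t - s) y powr (1 + \<beta>)) x))"


section \<open>Super-Brownian motion with stable branching\<close>

text \<open>A strong Markov family \<open>(P \<mu>)\<close>, indexed by the starting point, of laws on a measurable
  space \<open>A\<close> with filtration \<open>F\<close> and coordinate process \<open>X\<close>. Only nonnegative times matter.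

  Stopping times are taken finite; for a general one \<open>T\<close>, the strong Markov property on
  \<open>{T < \<infinity>}\<close> is that at all \<open>min T n\<close>.

  In \<open>log_laplace\<close>, \<open>V\<close> ranges over the solutions of the mild equation, of which there is
  exactly one on nonnegative times.\<close>

locale stable_super_brownian_motion = filtration "space A" F
  for A :: "'w measure" and F :: "real \<Rightarrow> 'w measure" +
  fixes \<beta> :: real
    and P :: "real measure \<Rightarrow> 'w measure"
    and X :: "real \<Rightarrow> 'w \<Rightarrow> real measure"
  assumes sets_filtration: "\<And>t. sets (F t) \<subseteq> sets A"
    and kernel: "P \<in> borel_finite_measures \<rightarrow>\<^sub>M prob_algebra A"
    and adapted: "\<And>t. 0 \<le> t \<Longrightarrow> X t \<in> F t \<rightarrow>\<^sub>M borel_finite_measures"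
    and cadlag_paths: "\<And>\<omega>. \<omega> \<in> space A \<Longrightarrow> cadlag (\<lambda>t. X t \<omega>)"
    and start: "\<And>\<mu>. \<mu> \<in> finite_measures \<Longrightarrow> AE \<omega> in P \<mu>. X 0 \<omega> = \<mu>"
    and strong_markov:
      "\<And>\<mu> T t g. \<mu> \<in> finite_measures \<Longrightarrow>
         stopping_time F T \<Longrightarrow> (\<And>\<omega>. \<omega> \<in> space A \<Longrightarrow> 0 \<le> T \<omega>) \<Longrightarrow> 0 \<le> t \<Longrightarrow>
         g \<in> borel_measurable borel_finite_measures \<Longrightarrow> bounded (g ` finite_measures) \<Longrightarrow>
         AE \<omega> in P \<mu>. real_cond_exp (P \<mu>) (pre_sigma T) (\<lambda>\<omega>. g (X (T \<omega> + t) \<omega>)) \<omega>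
           = (\<integral>\<omega>'. g (X t \<omega>') \<partial>P (X (T \<omega>) \<omega>))"
    and log_laplace:
      "\<And>\<mu> \<phi> f V t. \<mu> \<in> finite_measures \<Longrightarrow>
         bounded_nonneg_borel \<phi> \<Longrightarrow> bounded_nonneg_borel f \<Longrightarrow> mild_solution \<beta> \<phi> f V \<Longrightarrow> 0 \<le> t \<Longrightarrow>
         (\<integral>\<omega>. exp (- (\<integral>x. \<phi> x \<partial>X t \<omega>) - (LBINT s:{0..t}. \<integral>x. f x \<partial>X s \<omega>)) \<partial>P \<mu>)
           = exp (- (\<integral>x. V t x \<partial>\<mu>))"


section \<open>Local time\<close>

text \<open>\<open>L t x \<omega>\<close> is a jointly continuous version of the density at \<open>x\<close> of the occupation measure
  of \<open>X\<close> up to time \<open>t\<close>.\<close>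

definition local_time ::
  "'w measure \<Rightarrow> (real \<Rightarrow> 'w \<Rightarrow> real measure) \<Rightarrow> (real \<Rightarrow> real \<Rightarrow> 'w \<Rightarrow> real) \<Rightarrow> bool" where
  "local_time M X L \<longleftrightarrow>
     (\<forall>t\<ge>0. \<forall>x. L t x \<in> borel_measurable M) \<and>
     (AE \<omega> in M.
        continuous_on ({0..} \<times> UNIV) (\<lambda>(t, x). L t x \<omega>) \<and>
        (\<forall>t\<ge>0. \<forall>x. 0 \<le> L t x \<omega>) \<and>
        (\<forall>t\<ge>0. \<forall>\<phi> \<in> borel_measurable borel.
           (\<integral>\<^sup>+s\<in>{0..t}. (\<integral>\<^sup>+x. \<phi> x \<partial>X s \<omega>) \<partial>lborel)
             = (\<integral>\<^sup>+x. \<phi> x * ennreal (L t x \<omega>) \<partial>lborel)))"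

definition extinction_time :: "(real \<Rightarrow> 'w \<Rightarrow> real measure) \<Rightarrow> 'w \<Rightarrow> ereal" where
  "extinction_time X \<omega> = Inf {ereal t | t. 0 \<le> t \<and> measure (X t \<omega>) UNIV = 0}"

text \<open>The local time at the extinction time, which is almost surely finite; on the exceptional
  null set the value is irrelevant. As \<open>A\<close> need not be complete, the hitting time of a closed set
  by a cadlag path, hence also the total local time, may be measurable only for the completion.\<close>

definition total_local_time ::
  "(real \<Rightarrow> 'w \<Rightarrow> real measure) \<Rightarrow> (real \<Rightarrow> real \<Rightarrow> 'w \<Rightarrow> real) \<Rightarrow> real \<Rightarrow> 'w \<Rightarrow> real" where
  "total_local_time X L x \<omega> = L (real_of_ereal (extinction_time X \<omega>)) x \<omega>"


section \<open>Positive stable laws\<close>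

definition positive_stable :: "real \<Rightarrow> real measure \<Rightarrow> bool" where
  "positive_stable \<alpha> \<nu> \<longleftrightarrow> 0 < \<alpha> \<and> \<alpha> < 1 \<and>
     prob_space \<nu> \<and> sets \<nu> = sets borel \<and> (AE x in \<nu>. 0 \<le> x) \<and>
     (\<exists>c>0. \<forall>l\<ge>0. (\<integral>x. exp (- l * x) \<partial>\<nu>) = exp (- c * l powr \<alpha>))"

end

theory Submission
  imports Defs
begin

text \<open>
  The function \<open>a (\<bar>x\<bar> + b)\<^sup>-\<^sup>2\<^sup>/\<^sup>\<beta>\<close>, with \<open>a\<^sup>\<beta> = (2/\<beta>)(2/\<beta> + 1)/2\<close>, solves
  \<open>V''/2 = V\<^sup>1\<^sup>+\<^sup>\<beta> - \<lambda> \<delta>\<^sub>0\<close> with \<open>\<lambda> = a (2/\<beta>) b\<^sup>-\<^sup>2\<^sup>/\<^sup>\<beta>\<^sup>-\<^sup>1\<close>.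
  Replacing \<open>\<bar>x\<bar>\<close> by \<open>sqrt (x\<^sup>2 + e\<^sup>2)\<close> turns \<open>\<lambda> \<delta>\<^sub>0\<close> into a bounded nonnegative function \<open>f\<close>, and the
  resulting \<open>V\<close> is a time-independent mild solution with initial value \<open>\<phi> = V\<close>, so no existence
  theory for the log-Laplace equation is needed. Since \<open>X\<close> dies out in finite time, \<open>t \<rightarrow> \<infinity>\<close> in the
  log-Laplace formula gives \<open>E exp (- \<integral> f(x) L\<^sup>x dx) = exp (- V(0))\<close>, and \<open>e \<rightarrow> 0\<close> gives
  \<open>E exp (- \<lambda> L\<^sup>0) = exp (- a b\<^sup>-\<^sup>2\<^sup>/\<^sup>\<beta>)\<close>, whose exponent is a multiple of
  \<open>\<lambda>\<close> to the power \<open>2/(2+\<beta>)\<close>.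

  Extinction follows from the solutions that are constant in space. That mass zero is never left
  again cannot be read off from the strong Markov property at the extinction time, which need not
  be a stopping time of the given filtration; instead it comes from a maximal inequality over
  finite sets of rational times.
\<close>

section \<open>Weak convergence of finite measures and regularity of cadlag paths\<close>

section \<open>Cadlag paths of finite measures\<close>

lemma finite_measuresD:
  assumes "\<mu> \<in> finite_measures"
  shows "finite_measure \<mu>" "sets \<mu> = sets borel" "space \<mu> = UNIV"
  using assms sets_eq_imp_space_eq[of \<mu> borel] by (auto simp: finite_measures_def)

lemma weak_topology_subbasis:
  fixes f :: "real \<Rightarrow> real"
  assumes "continuous_on UNIV f" "bounded (range f)" "open U"
  shows "openin weak_topology {\<mu> \<in> finite_measures. (\<integral>x. f x \<partial>\<mu>) \<in> U}"
  unfolding weak_topology_def by (rule topology_generated_by_Basis) (use assms in blast)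

lemma topspace_weak_topology: "topspace weak_topology = finite_measures"
proof
  show "topspace weak_topology \<subseteq> finite_measures"
    unfolding weak_topology_def topology_generated_by_topspace by auto
  \<comment> \<open>The zero function with \<open>U = UNIV\<close> makes all of
    \<open>finite_measures\<close> a subbasic open set.\<close>
  have "openin weak_topology {\<mu> \<in> finite_measures. (\<integral>x. 0 \<partial>\<mu>) \<in> (UNIV :: real set)}"
    by (rule weak_topology_subbasis) auto
  then show "finite_measures \<subseteq> topspace weak_topology"
    by (metis (mono_tags, lifting) Collect_mem_eq UNIV_I Collect_cong openin_subset)
qed

lemma space_borel_finite_measures: "space borel_finite_measures = finite_measures"
  unfolding borel_finite_measures_def
  by (rule space_measure_of) (use openin_subset topspace_weak_topology in fastforce)

lemma tendsto_integral_weak: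
  fixes f :: "real \<Rightarrow> real"
  assumes "limitin weak_topology w l G" "continuous_on UNIV f" "bounded (range f)"
  shows "((\<lambda>t. \<integral>x. f x \<partial>w t) \<longlongrightarrow> (\<integral>x. f x \<partial>l)) G"
proof (rule topological_tendstoI)
  fix U :: "real set" assume "open U" "(\<integral>x. f x \<partial>l) \<in> U"
  moreover have "l \<in> finite_measures"
    using assms(1) limitin_topspace topspace_weak_topology by metis
  ultimately have "\<forall>\<^sub>F t in G. w t \<in> {\<mu> \<in> finite_measures. (\<integral>x. f x \<partial>\<mu>) \<in> U}"
    using assms(1) weak_topology_subbasis[OF assms(2,3)] unfolding limitin_def by blast
  then show "\<forall>\<^sub>F t in G. (\<integral>x. f x \<partial>w t) \<in> U"
    by eventually_elim auto
qed

lemma measurable_integral_finite_measures: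
  fixes f :: "real \<Rightarrow> real"
  assumes "continuous_on UNIV f" "bounded (range f)"
  shows "(\<lambda>\<mu>. \<integral>x. f x \<partial>\<mu>) \<in> borel_measurable borel_finite_measures"
proof (rule borel_measurableI)
  fix U :: "real set" assume "open U"
  then have "openin weak_topology {\<mu> \<in> finite_measures. (\<integral>x. f x \<partial>\<mu>) \<in> U}"
    using assms weak_topology_subbasis by blast
  moreover have "(\<lambda>\<mu>. \<integral>x. f x \<partial>\<mu>) -` U \<inter> space borel_finite_measures
      = {\<mu> \<in> finite_measures. (\<integral>x. f x \<partial>\<mu>) \<in> U}"
    by (auto simp: space_borel_finite_measures)
  moreover have "{U. openin weak_topology U} \<subseteq> Pow finite_measures"
    using openin_subset topspace_weak_topology by fastforce
  ultimately show "(\<lambda>\<mu>. \<integral>x. f x \<partial>\<mu>) -` U \<inter> space borel_finite_measures \<in> sets borel_finite_measures"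
    unfolding borel_finite_measures_def by auto
qed

lemma integral_one_finite_measures:
  "\<mu> \<in> finite_measures \<Longrightarrow> (\<integral>x. 1 \<partial>\<mu>) = measure \<mu> UNIV"
  using finite_measuresD(3)[of \<mu>] by simp

text \<open>The function is a pointwise limit of step functions: s is replaced by the next point
  \<open>h n s\<close> on the grid of mesh 1/(n+1). Floor plus one keeps \<open>h n s\<close>
  strictly above s even at grid points, as \<open>at_right s\<close> requires. The indicator cuts
  off negative times, at which nothing is known.\<close>

lemma borel_measurable_right_continuous:
  fixes g :: "real \<Rightarrow> real"
  assumes "\<And>t. 0 \<le> t \<Longrightarrow> (g \<longlongrightarrow> g t) (at_right t)"
  shows "(\<lambda>s. indicator {0..} s * g s) \<in> borel_measurable borel"
proof (rule borel_measurable_LIMSEQ_real)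
  define h where "h n s = (of_int \<lfloor>real (Suc n) * s\<rfloor> + 1) / real (Suc n)" for n s
  show "(\<lambda>n. indicator {0..} s * g (h n s)) \<longlonglongrightarrow> indicator {0..} s * g s" for s
  proof (cases "0 \<le> s")
    case True
    have gt: "h n s > s" for n
    proof -
      have "real (Suc n) * s < of_int \<lfloor>real (Suc n) * s\<rfloor> + 1" by linarith
      then show ?thesis unfolding h_def by (simp add: field_simps)
    qed
    have le: "h n s \<le> s + 1 / real (Suc n)" for n
    proof -
      have "of_int \<lfloor>real (Suc n) * s\<rfloor> + 1 \<le> real (Suc n) * s + 1" by linarith
      then have "h n s \<le> (real (Suc n) * s + 1) / real (Suc n)"
        unfolding h_def by (rule divide_right_mono) simp
      also have "\<dots> = s + 1 / real (Suc n)" by (simp add: field_simps)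
      finally show ?thesis .
    qed
    have "(\<lambda>n. s + 1 / real (Suc n)) \<longlonglongrightarrow> s + 0"
      by (intro tendsto_add tendsto_const LIMSEQ_Suc lim_1_over_n)
    then have "(\<lambda>n. h n s) \<longlonglongrightarrow> s"
      using gt le
      by (intro tendsto_sandwich[of "\<lambda>_. s" "\<lambda>n. h n s" sequentially "\<lambda>n. s + 1 / real (Suc n)"])
         (auto intro!: always_eventually less_imp_le)
    then have "filterlim (\<lambda>n. h n s) (at_right s) sequentially"
      using gt by (auto simp: filterlim_at less_imp_neq[THEN not_sym] intro!: always_eventually)
    from filterlim_compose[OF assms[OF True] this] show ?thesis
      by (intro tendsto_mult tendsto_const)
  qed simp
  show "(\<lambda>s. indicator {0..} s * g (h n s)) \<in> borel_measurable borel" for n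
  proof -
    have "(\<lambda>s. (\<lambda>k::int. g ((of_int k + 1) / real (Suc n))) \<lfloor>real (Suc n) * s\<rfloor>) \<in> borel_measurable borel"
      by measurable
    then show ?thesis unfolding h_def by measurable
  qed
qed

lemma cadlag_finite_measures: "cadlag w \<Longrightarrow> 0 \<le> t \<Longrightarrow> w t \<in> finite_measures"
  using limitin_topspace topspace_weak_topology unfolding cadlag_def by metis

lemma cadlag_integral_right_continuous:
  fixes f :: "real \<Rightarrow> real"
  assumes "cadlag w" "continuous_on UNIV f" "bounded (range f)" "0 \<le> t"
  shows "((\<lambda>s. \<integral>x. f x \<partial>w s) \<longlongrightarrow> (\<integral>x. f x \<partial>w t)) (at_right t)"
  using assms tendsto_integral_weak unfolding cadlag_def by blast

lemma cadlag_mass_right_continuous: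
  assumes "cadlag w" "0 \<le> t"
  shows "((\<lambda>s. measure (w s) UNIV) \<longlongrightarrow> measure (w t) UNIV) (at_right t)"
proof -
  have "((\<lambda>s. \<integral>x. (1::real) \<partial>w s) \<longlongrightarrow> (\<integral>x. 1 \<partial>w t)) (at_right t)"
    by (rule cadlag_integral_right_continuous[OF assms(1) _ _ assms(2)]) auto
  then have "((\<lambda>s. \<integral>x. 1 \<partial>w s) \<longlongrightarrow> measure (w t) UNIV) (at_right t)"
    using assms by (simp only: integral_one_finite_measures cadlag_finite_measures)
  moreover have "\<forall>\<^sub>F s in at_right t. (\<integral>x. 1 \<partial>w s) = measure (w s) UNIV"
    using assms
    by (intro eventually_mono[OF eventually_at_right_less[of t]] integral_one_finite_measures
        cadlag_finite_measures) auto
  ultimately show ?thesis by (rule Lim_transform_eventually)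
qed

text \<open>The limits from both sides make the mass locally bounded near each time, and bisection
  passes from local bounds to a bound on the compact interval.\<close>

lemma cadlag_mass_bounded:
  assumes "cadlag w"
  shows "\<exists>C. \<forall>s\<in>{0..T}. measure (w s) UNIV \<le> C"
proof (cases "0 \<le> T")
  case True
  let ?Y = "\<lambda>s. measure (w s) UNIV"
  \<comment> \<open>The intersection with \<open>{0..}\<close> is taken because intervals around 0
    reach into negative times, at which the path is arbitrary.\<close>
  define Q where "Q a b \<longleftrightarrow> (\<exists>C. \<forall>s\<in>{a..b} \<inter> {0..}. ?Y s \<le> C)" for a b :: real
  have "Q 0 T"
    using True
  proof (rule Bolzano[where P = Q])
    fix a b c assume "Q a b" "Q b c" "a \<le> b" "b \<le> c"
    then obtain C D where "\<forall>s\<in>{a..b} \<inter> {0..}. ?Y s \<le> C" "\<forall>s\<in>{b..c} \<inter> {0..}. ?Y s \<le> D" unfolding Q_def by blast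
    then have "\<forall>s\<in>{a..c} \<inter> {0..}. ?Y s \<le> max C D" by (auto simp: le_max_iff_disj)
    then show "Q a c" unfolding Q_def by blast
  next
    fix x :: real assume x: "0 \<le> x"
    have "\<forall>\<^sub>F s in at_right x. ?Y s < ?Y x + 1"
      using cadlag_mass_right_continuous[OF assms x] by (auto simp: order_tendsto_iff)
    then obtain d1 where d1: "d1 > x" "\<And>s. x < s \<Longrightarrow> s < d1 \<Longrightarrow> ?Y s < ?Y x + 1"
      unfolding eventually_at_right_field by blast
    have "\<exists>d2<x. \<exists>C. \<forall>s. d2 < s \<longrightarrow> s < x \<longrightarrow> 0 \<le> s \<longrightarrow> ?Y s \<le> C"
    proof (cases "x = 0")
      case True
      \<comment> \<open>There are no nonnegative times to the left of 0, so any negative number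
        serves.\<close>
      then show ?thesis by (intro exI[of _ "-1"]) auto
    next
      case False
      then obtain l where l: "limitin weak_topology w l (at_left x)"
        using assms x unfolding cadlag_def by force
      have "\<forall>\<^sub>F s in at_left x. (\<integral>x. 1 \<partial>w s) < (\<integral>x. 1 \<partial>l) + (1::real)"
        using tendsto_integral_weak[OF l, of "\<lambda>_. 1"] by (auto simp: order_tendsto_iff)
      then obtain d2 where d2: "d2 < x" "\<And>s. d2 < s \<Longrightarrow> s < x \<Longrightarrow> (\<integral>x. 1 \<partial>w s) < (\<integral>x. 1 \<partial>l) + (1::real)"
        unfolding eventually_at_left_field by blast
      have "?Y s \<le> (\<integral>x. 1 \<partial>l) + 1" if "d2 < s" "s < x" "0 \<le> s" for s
        using d2(2)[OF that(1,2)] integral_one_finite_measures[OF cadlag_finite_measures[OF assms that(3)]]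
        by linarith
      then show ?thesis using d2(1) by blast
    qed
    then obtain d2 C where d2: "d2 < x" "\<And>s. d2 < s \<Longrightarrow> s < x \<Longrightarrow> 0 \<le> s \<Longrightarrow> ?Y s \<le> C" by blast
    show "\<exists>d>0. \<forall>a b. a \<le> x \<and> x \<le> b \<and> b - a < d \<longrightarrow> Q a b"
    proof (intro exI[of _ "min (d1 - x) (x - d2)"] conjI allI impI)
      fix a b assume ab: "a \<le> x \<and> x \<le> b \<and> b - a < min (d1 - x) (x - d2)"
      have "?Y s \<le> max C (?Y x + 1)" if "s \<in> {a..b} \<inter> {0..}" for s
      proof -
        consider "s < x" | "s = x" | "x < s" by linarith
        then show ?thesis
        proof cases
          case 1 then show ?thesis using d2(2)[of s] that ab by auto
        next
          case 3 then show ?thesis using d1(2)[of s] that ab by auto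
        qed auto
      qed
      then show "Q a b" unfolding Q_def by blast
    qed (use d1(1) d2(1) in auto)
  qed
  then show ?thesis unfolding Q_def by auto
qed auto

section \<open>Gaussian integration by parts and Dynkin's formula for the heat semigroup\<close>

section \<open>The heat semigroup on smooth functions\<close>

text \<open>Stein's identity. Minus the product of the normal density and \<open>G\<close> is an
  antiderivative of the difference of the two integrands, and it vanishes at both infinities because
  \<open>G\<close> is bounded.\<close>

lemma gaussian_integration_by_parts:
  fixes G G' :: "real \<Rightarrow> real"
  assumes deriv: "\<And>x. (G has_real_derivative G' x) (at x)"
    and cont: "continuous_on UNIV G'"
    and bounds: "\<And>x. \<bar>G x\<bar> \<le> B" "\<And>x. \<bar>G' x\<bar> \<le> B"
  shows "(\<integral>z. std_normal_density z * (z * G z) \<partial>lborel) = (\<integral>z. std_normal_density z * G' z \<partial>lborel)"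
proof -
  let ?n = std_normal_density
  have [measurable]: "G \<in> borel_measurable borel" "G' \<in> borel_measurable borel"
    using deriv cont by (auto intro!: borel_measurable_continuous_onI continuous_at_imp_continuous_on DERIV_isCont)
  have G_cont: "isCont G x" "isCont G' x" for x
    using deriv cont by (auto simp: continuous_on_eq_continuous_at intro: DERIV_isCont)
  have int1: "integrable lborel (\<lambda>z. ?n z * (z * G z))"
  proof (rule Bochner_Integration.integrable_bound)
    show "integrable lborel (\<lambda>z. B * (?n z * \<bar>z\<bar>^1))"
      by (intro integrable_mult_right integrable_std_normal_moment_abs)
    have "\<bar>z * G z\<bar> \<le> B * \<bar>z\<bar>" for z
      using mult_left_mono[OF bounds(1)[of z], of "\<bar>z\<bar>"] by (simp add: abs_mult mult.commute)
    then have "\<bar>?n z * (z * G z)\<bar> \<le> ?n z * (B * \<bar>z\<bar>)" for z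
      unfolding abs_mult[of "?n z"] by (simp add: mult_left_mono)
    then show "AE z in lborel. norm (?n z * (z * G z)) \<le> norm (B * (?n z * \<bar>z\<bar>^1))"
      by (intro AE_I2) (simp add: algebra_simps order_trans[OF _ abs_ge_self])
  qed simp
  have int2: "integrable lborel (\<lambda>z. ?n z * G' z)"
  proof (rule Bochner_Integration.integrable_bound)
    show "integrable lborel (\<lambda>z. B * ?n z)"
      by (intro integrable_mult_right integrable_normal_density) simp
    show "AE z in lborel. norm (?n z * G' z) \<le> norm (B * ?n z)"
      using bounds(2) by (intro AE_I2) (simp add: abs_mult mult.commute mult_right_mono order_trans[OF _ abs_ge_self])
  qed simp
  let ?F = "\<lambda>z. - (?n z * G z)"
  let ?f = "\<lambda>z. ?n z * (z * G z) - ?n z * G' z"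
  have lim: "((\<lambda>z. ?F z) \<longlongrightarrow> 0) F" if "(?n \<longlongrightarrow> 0) F" for F
  proof (rule Lim_null_comparison)
    show "((\<lambda>z. B * ?n z) \<longlongrightarrow> 0) F" using that by (rule tendsto_mult_right_zero)
    show "\<forall>\<^sub>F z in F. norm (?F z) \<le> B * ?n z"
      using bounds(1) by (intro always_eventually) (simp add: abs_mult mult.commute mult_right_mono)
  qed
  have n_lim: "(?n \<longlongrightarrow> 0) at_top" "(?n \<longlongrightarrow> 0) at_bot"
    unfolding std_normal_density_def by real_asymp+
  have int_f: "integrable lborel ?f"
    using int1 int2 by (rule Bochner_Integration.integrable_diff)
  have "(LBINT z=-\<infinity>..\<infinity>. ?f z) = 0 - 0"
  proof (rule interval_integral_FTC_integrable[where F = ?F])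
    fix z
    have "(?n has_real_derivative - z * ?n z) (at z)"
      unfolding std_normal_density_def
      by (auto intro!: derivative_eq_intros simp: field_simps)
    then have "(?F has_real_derivative ?f z) (at z)"
      by (auto intro!: derivative_eq_intros deriv simp: algebra_simps)
    then show "(?F has_vector_derivative ?f z) (at z)"
      by (simp add: has_real_derivative_iff_has_vector_derivative)
    show "isCont ?f z"
      unfolding std_normal_density_def by (intro continuous_intros G_cont) auto
  next
    show "set_integrable lborel (einterval (- \<infinity>) \<infinity>) ?f"
      using int_f by (simp add: set_integrable_def einterval_def)
    show "((?F \<circ> real_of_ereal) \<longlongrightarrow> 0) (at_right (- \<infinity>))"
      using lim[OF n_lim(2)] by (simp add: ereal_tendsto_simps)
    show "((?F \<circ> real_of_ereal) \<longlongrightarrow> 0) (at_left \<infinity>)"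
      using lim[OF n_lim(1)] by (simp add: ereal_tendsto_simps)
  qed simp
  then have "(\<integral>z. ?f z \<partial>lborel) = 0"
    by (simp add: interval_lebesgue_integral_def set_lebesgue_integral_def einterval_def)
  then show ?thesis
    using int1 int2 by simp
qed

text \<open>Scaling gives the form E[g(x + sqrt(s) Z)] with Z standard normal. It also covers s = 0,
  which \<open>heat_semigroup\<close> treats separately, and it moves s into the argument of
  \<open>g\<close>, where smoothness of \<open>g\<close> can be used.\<close>

lemma heat_semigroup_std_normal:
  assumes "0 \<le> s" "g \<in> borel_measurable borel"
  shows "heat_semigroup s g x = (\<integral>z. std_normal_density z * g (x + sqrt s * z) \<partial>lborel)"
proof (cases "s = 0")
  case True
  then show ?thesis by (simp add: heat_semigroup_def)
next
  case False
  with assms have "0 < s" by simp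
  have "(\<integral>y. normal_density x (sqrt s) y * g y \<partial>lborel)
      = \<bar>sqrt s\<bar> *\<^sub>R (\<integral>z. normal_density x (sqrt s) (x + sqrt s * z) * g (x + sqrt s * z) \<partial>lborel)"
    using \<open>0 < s\<close> by (intro lborel_integral_real_affine) simp
  also have "\<dots> = (\<integral>z. sqrt s * (normal_density x (sqrt s) (x + sqrt s * z) * g (x + sqrt s * z)) \<partial>lborel)"
    using \<open>0 < s\<close> by simp
  also have "\<dots> = (\<integral>z. std_normal_density z * g (x + sqrt s * z) \<partial>lborel)"
    using \<open>0 < s\<close>
    by (intro Bochner_Integration.integral_cong)
       (auto simp: normal_density_def power_mult_distrib real_sqrt_mult)
  finally show ?thesis using \<open>0 < s\<close> by (simp add: heat_semigroup_def)
qed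

lemma integrable_std_normal_bounded:
  fixes g :: "real \<Rightarrow> real"
  assumes "g \<in> borel_measurable borel" "\<And>x. \<bar>g x\<bar> \<le> B"
  shows "integrable lborel (\<lambda>z. std_normal_density z * g z)"
proof (rule Bochner_Integration.integrable_bound)
  show "integrable lborel (\<lambda>z. B * std_normal_density z)"
    by (intro integrable_mult_right integrable_normal_density) simp
  show "AE z in lborel. norm (std_normal_density z * g z) \<le> norm (B * std_normal_density z)"
    using assms(2) by (intro AE_I2) (simp add: abs_mult mult.commute mult_right_mono order_trans[OF _ abs_ge_self])
qed (use assms in measurable)

lemma heat_semigroup_continuous:
  fixes g :: "real \<Rightarrow> real"
  assumes cont: "continuous_on UNIV g" and bound: "\<And>x. \<bar>g x\<bar> \<le> B"
  shows "continuous_on {0..} (\<lambda>s. heat_semigroup s g x)"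
proof -
  have [measurable]: "g \<in> borel_measurable borel" using cont by (rule borel_measurable_continuous_onI)
  have g: "isCont g y" for y using cont by (simp add: continuous_on_eq_continuous_at)
  have "continuous_on {0..} (\<lambda>s. \<integral>z. std_normal_density z * g (x + sqrt s * z) \<partial>lborel)"
    unfolding continuous_on_sequentially
  proof safe
    fix u :: "nat \<Rightarrow> real" and a
    assume u: "u \<longlonglongrightarrow> a"
    show "((\<lambda>s. \<integral>z. std_normal_density z * g (x + sqrt s * z) \<partial>lborel) \<circ> u)
        \<longlonglongrightarrow> (\<integral>z. std_normal_density z * g (x + sqrt a * z) \<partial>lborel)"
      unfolding o_def
    proof (rule integral_dominated_convergence)
      show "integrable lborel (\<lambda>z. B * std_normal_density z)"
        by (intro integrable_mult_right integrable_normal_density) simp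
      show "AE z in lborel. (\<lambda>i. std_normal_density z * g (x + sqrt (u i) * z))
          \<longlonglongrightarrow> std_normal_density z * g (x + sqrt a * z)"
        using u by (intro AE_I2 tendsto_intros isCont_tendsto_compose[OF g])
      show "AE z in lborel. norm (std_normal_density z * g (x + sqrt (u i) * z)) \<le> B * std_normal_density z" for i
      proof (rule AE_I2)
        fix z
        show "norm (std_normal_density z * g (x + sqrt (u i) * z)) \<le> B * std_normal_density z"
          using mult_right_mono[OF bound[of "x + sqrt (u i) * z"] normal_density_nonneg[of 0 1 z]]
          by (simp add: abs_mult mult.commute)
      qed
    qed simp_all
  qed
  then show ?thesis
    by (rule continuous_on_cong[THEN iffD1, rotated -1])
       (auto simp: heat_semigroup_std_normal)
qed

text \<open>Dynkin's formula for Brownian motion. With s = u^2 the integrand becomes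
  E[u V''(x + u Z)], which Gaussian integration by parts turns into E[Z V'(x + u Z)], the expected
  u-derivative of V(x + u Z). Fubini and the fundamental theorem of calculus in u then give
  E[V(x + r Z)] - V(x) with r^2 = t.\<close>

lemma heat_semigroup_C2:
  fixes V V' V'' :: "real \<Rightarrow> real"
  assumes V': "\<And>x. (V has_real_derivative V' x) (at x)"
    and V'': "\<And>x. (V' has_real_derivative V'' x) (at x)"
    and cont: "continuous_on UNIV V''"
    and bounds: "\<And>x. \<bar>V x\<bar> \<le> B" "\<And>x. \<bar>V' x\<bar> \<le> B" "\<And>x. \<bar>V'' x\<bar> \<le> B"
    and t: "0 \<le> t"
  shows "(LBINT s:{0..t}. heat_semigroup s (\<lambda>y. V'' y / 2) x) = heat_semigroup t V x - V x"
proof -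
  let ?n = std_normal_density
  define r where "r = sqrt t"
  have r: "0 \<le> r" "r\<^sup>2 = t" using t by (auto simp: r_def)
  have V'_cont: "continuous_on UNIV V'" "continuous_on UNIV V"
    using V' V'' by (auto intro!: continuous_at_imp_continuous_on DERIV_isCont)
  have [measurable]: "V \<in> borel_measurable borel" "V' \<in> borel_measurable borel" "V'' \<in> borel_measurable borel"
    using V'_cont cont by (auto intro!: borel_measurable_continuous_onI)
  have B: "0 \<le> B" using bounds(1)[of 0] by linarith
  let ?H = "\<lambda>u. heat_semigroup u (\<lambda>y. V'' y / 2) x"
  have H_cont: "continuous_on {0..} ?H"
    using cont bounds(3) B
    by (intro heat_semigroup_continuous[where B = B] continuous_intros) (auto simp: abs_le_iff, (smt (verit))+)
  have "(LBINT s:{0..t}. ?H s) = (LBINT s=ereal 0..ereal t. ?H s)"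
    using t by (simp add: interval_integral_Icc)
  also have "\<dots> = (LBINT u=ereal 0..ereal r. (2 * u) *\<^sub>R ?H (u\<^sup>2))"
  proof -
    have "(LBINT u=ereal 0..ereal r. (2 * u) *\<^sub>R ?H (u\<^sup>2)) = (LBINT s=ereal (0\<^sup>2)..ereal (r\<^sup>2). ?H s)"
      using r by (intro interval_integral_substitution_finite)
        (auto intro!: derivative_eq_intros continuous_intros continuous_on_subset[OF H_cont])
    then show ?thesis using r by simp
  qed
  also have "\<dots> = (LBINT u:{0..r}. (2 * u) *\<^sub>R ?H (u\<^sup>2))"
    using r by (simp add: interval_integral_Icc)
  also have "\<dots> = (LBINT u:{0..r}. \<integral>z. ?n z * (z * V' (x + u * z)) \<partial>lborel)"
  proof (rule set_lebesgue_integral_cong)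
    show "\<forall>u. u \<in> {0..r} \<longrightarrow> (2 * u) *\<^sub>R ?H (u\<^sup>2) = (\<integral>z. ?n z * (z * V' (x + u * z)) \<partial>lborel)"
    proof safe
      fix u assume u: "u \<in> {0..r}"
      have "(\<integral>z. ?n z * (z * V' (x + u * z)) \<partial>lborel) = (\<integral>z. ?n z * (V'' (x + u * z) * u) \<partial>lborel)"
      proof (rule gaussian_integration_by_parts)
        show "((\<lambda>z. V' (x + u * z)) has_real_derivative V'' (x + u * z) * u) (at z)" for z
          by (rule DERIV_chain2[OF V'']) (auto intro!: derivative_eq_intros)
        show "continuous_on UNIV (\<lambda>z. V'' (x + u * z) * u)"
          by (intro continuous_intros continuous_on_compose2[OF cont]) auto
        have ur: "\<bar>u\<bar> \<le> r" using u by auto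
        \<comment> \<open>Integration by parts takes one bound for a function and its derivative.
          The z-derivative carries a factor u at most r, hence the constant B (1 + r).\<close>
        show "\<bar>V' (x + u * z)\<bar> \<le> B * (1 + r)" for z
          using bounds(2)[of "x + u * z"] mult_nonneg_nonneg[OF B r(1)] by (simp add: algebra_simps)
        show "\<bar>V'' (x + u * z) * u\<bar> \<le> B * (1 + r)" for z
          unfolding abs_mult using ur B r(1) by (intro mult_mono bounds(3)) auto
      qed
      also have "\<dots> = (2 * u) *\<^sub>R ?H (u\<^sup>2)"
        using u by (subst heat_semigroup_std_normal)
          (auto simp: mult_ac simp flip: Bochner_Integration.integral_mult_right_zero)
      finally show "(2 * u) *\<^sub>R ?H (u\<^sup>2) = (\<integral>z. ?n z * (z * V' (x + u * z)) \<partial>lborel)" by simp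
    qed
  qed simp
  also have "\<dots> = (\<integral>u. (\<integral>z. indicator {0..r} u * (?n z * (z * V' (x + u * z))) \<partial>lborel) \<partial>lborel)"
    unfolding set_lebesgue_integral_def by simp
  also have "\<dots> = (\<integral>z. (\<integral>u. indicator {0..r} u * (?n z * (z * V' (x + u * z))) \<partial>lborel) \<partial>lborel)"
  proof (rule lborel_pair.Fubini_integral)
    \<comment> \<open>The majorant for Fubini: the first absolute Gaussian moment in z, on a bounded
      interval in u.\<close>
    let ?D = "\<lambda>(z, u). indicator {0..r} u * (B * (?n z * \<bar>z\<bar>^1)) :: real"
    have "integrable (lborel \<Otimes>\<^sub>M lborel) ?D"
    proof (rule lborel_pair.Fubini_integrable)
      have "(\<lambda>z. \<integral>u. norm (?D (z, u)) \<partial>lborel) = (\<lambda>z. r * B * (?n z * \<bar>z\<bar>^1))"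
        using r B by (simp add: abs_mult mult.assoc)
      then show "integrable lborel (\<lambda>z. \<integral>u. norm (?D (z, u)) \<partial>lborel)"
        by (simp only:) (intro integrable_mult_right integrable_std_normal_moment_abs)
      have "integrable lborel (indicat_real {0..r})"
        by (rule integrable_real_indicator) (auto simp: emeasure_lborel_Icc_eq)
      then show "AE z in lborel. integrable lborel (\<lambda>u. ?D (z, u))"
        by simp
    qed (simp add: split_beta')
    then show "integrable (lborel \<Otimes>\<^sub>M lborel) (\<lambda>(z, u). indicator {0..r} u * (?n z * (z * V' (x + u * z))))"
    proof (rule Bochner_Integration.integrable_bound)
      have "\<bar>?n z * (z * V' (x + u * z))\<bar> \<le> B * (?n z * \<bar>z\<bar>)" for z u
        using mult_left_mono[OF bounds(2)[of "x + u * z"], of "?n z * \<bar>z\<bar>"] by (simp add: abs_mult mult_ac)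
      then show "AE p in lborel \<Otimes>\<^sub>M lborel. norm (case p of (z, u) \<Rightarrow> indicator {0..r} u * (?n z * (z * V' (x + u * z)))) \<le> norm (?D p)"
        using B by (intro AE_I2) (auto simp: abs_mult split: split_indicator)
    qed (simp add: split_beta')
  qed
  also have "\<dots> = (\<integral>z. ?n z * (V (x + r * z) - V x) \<partial>lborel)"
  proof (rule Bochner_Integration.integral_cong[OF refl])
    fix z
    have "(LBINT u=ereal 0..ereal r. z * V' (x + u * z)) = V (x + r * z) - V (x + 0 * z)"
    proof (rule interval_integral_FTC_finite)
      show "continuous_on {min 0 r..max 0 r} (\<lambda>u. z * V' (x + u * z))"
        by (intro continuous_intros continuous_on_compose2[OF V'_cont(1)]) auto
      fix u
      have "((\<lambda>u. V (x + u * z)) has_real_derivative z * V' (x + u * z)) (at u)"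
        by (rule DERIV_chain2[OF V', THEN DERIV_cong]) (auto intro!: derivative_eq_intros)
      then show "((\<lambda>u. V (x + u * z)) has_vector_derivative z * V' (x + u * z)) (at u within {min 0 r..max 0 r})"
        by (metis has_real_derivative_iff_has_vector_derivative has_vector_derivative_at_within)
    qed
    then have "(LBINT u:{0..r}. z * V' (x + u * z)) = V (x + r * z) - V x"
      using r by (simp add: interval_integral_Icc zero_ereal_def)
    then show "(\<integral>u. indicator {0..r} u * (?n z * (z * V' (x + u * z))) \<partial>lborel) = ?n z * (V (x + r * z) - V x)"
      unfolding set_lebesgue_integral_def
      by (simp add: mult.left_commute[of _ "?n z"])
  qed
  also have "\<dots> = (\<integral>z. ?n z * V (x + r * z) \<partial>lborel) - (\<integral>z. ?n z * V x \<partial>lborel)"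
    unfolding right_diff_distrib using bounds(1)
    by (intro Bochner_Integration.integral_diff integrable_std_normal_bounded[where B = B]) auto
  also have "\<dots> = heat_semigroup t V x - V x"
    using t by (simp add: heat_semigroup_std_normal r_def)
  finally show ?thesis .
qed

section \<open>Two kinds of explicit solutions: constant in space and constant in time\<close>

section \<open>Explicit mild solutions\<close>

lemma heat_semigroup_const: "0 \<le> s \<Longrightarrow> heat_semigroup s (\<lambda>_. c) x = c"
  by (simp add: heat_semigroup_def)

text \<open>The function solves v' = - v^(1+\<beta>) with v(0) = \<theta>, since its power -\<beta>
  grows linearly with slope \<beta>. The semigroup fixes constants, so the mild equation is this
  differential equation in integrated form.\<close>

lemma mild_solution_constant:
  fixes \<beta> \<theta> :: real
  assumes "0 < \<beta>" "0 < \<theta>"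
  shows "mild_solution \<beta> (\<lambda>_. \<theta>) (\<lambda>_. 0) (\<lambda>t _. (\<theta> powr (- \<beta>) + \<beta> * t) powr (- (1 / \<beta>)))"
proof -
  let ?w = "\<lambda>t. \<theta> powr (- \<beta>) + \<beta> * t"
  let ?v = "\<lambda>t. ?w t powr (- (1 / \<beta>))"
  have w_ge: "\<theta> powr (- \<beta>) \<le> ?w t" if "0 \<le> t" for t
    using assms that by simp
  have w_pos: "0 < ?w t" if "0 \<le> t" for t
    using w_ge[OF that] assms by (smt (verit) powr_gt_zero)
  have v0: "?v 0 = \<theta>"
    using assms by (simp add: powr_powr)
  have v_le: "?v t \<le> \<theta>" if "0 \<le> t" for t
  proof -
    have "?v t \<le> (\<theta> powr (- \<beta>)) powr (- (1 / \<beta>))"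
      using assms w_ge[OF that] by (intro powr_mono2') auto
    then show ?thesis using v0 by simp
  qed
  have deriv: "((\<lambda>s. ?v (t - s)) has_real_derivative ?v (t - s) powr (1 + \<beta>)) (at s)"
    if "s \<le> t" for s t
  proof -
    have "((\<lambda>s. ?v (t - s)) has_real_derivative
        - (1 / \<beta>) * ?w (t - s) powr (- (1 / \<beta>) - 1) * - \<beta>) (at s)"
      using w_pos[of "t - s"] that
      by (auto intro!: derivative_eq_intros DERIV_powr[THEN DERIV_cong] simp: field_simps)
    moreover have "?v (t - s) powr (1 + \<beta>) = ?w (t - s) powr (- (1 / \<beta>) - 1)"
    proof -
      have "- (1 / \<beta>) * (1 + \<beta>) = - (1 / \<beta>) - 1" using assms by (simp add: field_simps)
      then show ?thesis by (simp only: powr_powr)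
    qed
    ultimately show ?thesis using assms by simp
  qed
  have eq: "?v t = heat_semigroup t (\<lambda>_. \<theta>) x +
      (LBINT s:{0..t}. heat_semigroup s (\<lambda>y. 0 - ?v (t - s) powr (1 + \<beta>)) x)" if t: "0 \<le> t" for t x
  proof -
    have "(LBINT s:{0..t}. heat_semigroup s (\<lambda>y. 0 - ?v (t - s) powr (1 + \<beta>)) x)
        = (LBINT s:{0..t}. - (?v (t - s) powr (1 + \<beta>)))"
      by (intro set_lebesgue_integral_cong) (auto simp: heat_semigroup_const)
    also have "\<dots> = - (LBINT s:{0..t}. ?v (t - s) powr (1 + \<beta>))"
      by (simp add: set_lebesgue_integral_def)
    also have "(LBINT s:{0..t}. ?v (t - s) powr (1 + \<beta>)) = (LBINT s=ereal 0..ereal t. ?v (t - s) powr (1 + \<beta>))"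
      using t by (simp add: interval_integral_Icc zero_ereal_def)
    also have "\<dots> = ?v (t - t) - ?v (t - 0)"
    proof (rule interval_integral_FTC_finite)
      show "continuous_on {min 0 t..max 0 t} (\<lambda>s. ?v (t - s) powr (1 + \<beta>))"
      proof (intro continuous_intros ballI)
        fix s assume "s \<in> {min 0 t..max 0 t}"
        then have "0 < ?w (t - s)" using t by (intro w_pos) auto
        then show "?w (t - s) \<noteq> 0" "?v (t - s) \<noteq> 0" by auto
      qed
      fix s assume "s \<le> max 0 t"
      then show "((\<lambda>s. ?v (t - s)) has_vector_derivative ?v (t - s) powr (1 + \<beta>)) (at s within {min 0 t..max 0 t})"
        using deriv[of s t] t
        by (auto simp: has_real_derivative_iff_has_vector_derivative has_vector_derivative_at_within)
    qed
    finally show ?thesis using t v0 by (simp add: heat_semigroup_const)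
  qed
  show ?thesis
    unfolding mild_solution_def
  proof (intro conjI allI impI)
    show "(\<lambda>(t, x). ?v t) \<in> borel_measurable (restrict_space borel ({0..} \<times> (UNIV :: real set)))"
      by (intro measurable_restrict_space1) (simp add: split_beta' borel_prod[symmetric])
    show "\<exists>C. \<forall>t\<in>{0..T}. \<forall>x::real. ?v t \<le> C" for T
      using v_le by (intro exI[of _ \<theta>]) simp
  qed (use eq in auto)
qed

text \<open>By the choice of \<open>f\<close> the time integrand of the mild equation is
  -P_s(V''/2), so the equation is \<open>heat_semigroup_C2\<close>. Starting from \<open>V\<close>
  itself is what keeps the solution fixed in time.\<close>

lemma mild_solution_stationary:
  fixes V V' V'' f :: "real \<Rightarrow> real"
  assumes V': "\<And>x. (V has_real_derivative V' x) (at x)"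
    and V'': "\<And>x. (V' has_real_derivative V'' x) (at x)"
    and cont: "continuous_on UNIV V''"
    and bounds: "\<And>x. \<bar>V x\<bar> \<le> B" "\<And>x. \<bar>V' x\<bar> \<le> B" "\<And>x. \<bar>V'' x\<bar> \<le> B"
    and nonneg: "\<And>x. 0 \<le> V x"
    and f: "\<And>x. f x = V x powr (1 + \<beta>) - V'' x / 2"
  shows "mild_solution \<beta> V f (\<lambda>_. V)"
proof -
  have V_meas: "V \<in> borel_measurable borel"
    using V' by (auto intro!: borel_measurable_continuous_onI continuous_at_imp_continuous_on DERIV_isCont)
  have neg: "heat_semigroup s (\<lambda>y. f y - V y powr (1 + \<beta>)) x = - heat_semigroup s (\<lambda>y. V'' y / 2) x" for s x
    unfolding heat_semigroup_def f by simp
  have eq: "V x = heat_semigroup t V x + (LBINT s:{0..t}. heat_semigroup s (\<lambda>y. f y - V y powr (1 + \<beta>)) x)"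
    if "0 \<le> t" for t x
    using heat_semigroup_C2[OF V' V'' cont bounds that, of x]
    unfolding neg by (simp add: set_lebesgue_integral_def)
  show ?thesis
    unfolding mild_solution_def
  proof (intro conjI allI impI)
    show "(\<lambda>(t :: real, x). V x) \<in> borel_measurable (restrict_space borel ({0..} \<times> UNIV))"
    proof (rule measurable_restrict_space1)
      have "(\<lambda>(t :: real, x). V x) \<in> borel_measurable (borel \<Otimes>\<^sub>M borel)" using V_meas by measurable
      then show "(\<lambda>(t :: real, x). V x) \<in> borel_measurable borel" by (simp only: borel_prod)
    qed
    show "\<exists>C. \<forall>t\<in>{0..T}. \<forall>x. V x \<le> C" for T :: real
      using bounds(1) abs_le_D1 by blast
  qed (use nonneg in blast, rule eq)
qed

section \<open>The smoothed stationary profile and its source term\<close>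

definition profile_scale :: "real \<Rightarrow> real" where
  "profile_scale \<beta> = ((2 / \<beta>) * (2 / \<beta> + 1) / 2) powr (1 / \<beta>)"

definition smooth_abs :: "real \<Rightarrow> real \<Rightarrow> real" where
  "smooth_abs e x = sqrt (x\<^sup>2 + e\<^sup>2)"

definition profile :: "real \<Rightarrow> real \<Rightarrow> real \<Rightarrow> real \<Rightarrow> real" where
  "profile \<beta> b e x = profile_scale \<beta> * (smooth_abs e x + b) powr (- (2 / \<beta>))"

text \<open>This is V^(1+\<beta>) - V''/2 for V = \<open>profile\<close>, with 1 - x^2/h^2 rewritten
  as e^2/h^2, where h = \<open>smooth_abs e x\<close>. In this form both summands are visibly
  nonnegative. As e tends to 0 the first becomes negligible and the second concentrates at the
  origin.\<close>

definition source :: "real \<Rightarrow> real \<Rightarrow> real \<Rightarrow> real \<Rightarrow> real" where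
  "source \<beta> b e x =
     profile_scale \<beta> * (2 / \<beta>) * (2 / \<beta> + 1) / 2 * (smooth_abs e x + b) powr (- (2 / \<beta>) - 2)
       * (e\<^sup>2 / smooth_abs e x ^ 2)
     + profile_scale \<beta> * (2 / \<beta>) / 2 * (smooth_abs e x + b) powr (- (2 / \<beta>) - 1)
       * (e\<^sup>2 / smooth_abs e x ^ 3)"

lemma smooth_abs_sq: "smooth_abs e x ^ 2 = x\<^sup>2 + e\<^sup>2"
  by (simp add: smooth_abs_def)

lemma smooth_abs_continuous: "continuous_on UNIV (smooth_abs e)"
  unfolding smooth_abs_def[abs_def] by (intro continuous_intros)

context
  fixes e :: real
  assumes e: "0 < e"
begin

lemma smooth_abs_pos: "0 < smooth_abs e x"
  using e by (simp add: smooth_abs_def sum_power2_gt_zero_iff)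

lemma smooth_abs_ge: "e \<le> smooth_abs e x" "\<bar>x\<bar> \<le> smooth_abs e x"
  using e by (auto simp: smooth_abs_def real_le_rsqrt abs_le_square_iff[symmetric])

lemma smooth_abs_deriv: "(smooth_abs e has_real_derivative x / smooth_abs e x) (at x)"
proof -
  have "x\<^sup>2 + e\<^sup>2 > 0" using e by (simp add: sum_power2_gt_zero_iff)
  then show ?thesis
    unfolding smooth_abs_def[abs_def] by (auto intro!: derivative_eq_intros simp: field_simps)
qed

lemma smooth_abs_deriv2: "((\<lambda>x. x / smooth_abs e x) has_real_derivative e\<^sup>2 / smooth_abs e x ^ 3) (at x)"
proof -
  let ?h = "smooth_abs e x"
  have h: "?h > 0" by (rule smooth_abs_pos)
  have "((\<lambda>x. x / smooth_abs e x) has_real_derivative (1 * ?h - x * (x / ?h)) / (?h * ?h)) (at x)"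
    using h by (auto intro!: derivative_eq_intros smooth_abs_deriv)
  moreover have "(1 * ?h - x * (x / ?h)) / (?h * ?h) = (?h ^ 2 - x\<^sup>2) / ?h ^ 3"
    using h by (simp add: field_simps power2_eq_square power3_eq_cube)
  ultimately show ?thesis by (simp add: smooth_abs_sq)
qed

end

lemma profile_scale_pos:
  assumes "0 < \<beta>"
  shows "0 < profile_scale \<beta>"
proof -
  have "0 < (2 / \<beta>) * (2 / \<beta> + 1) / 2" using assms by (simp add: add_pos_pos)
  then show ?thesis unfolding profile_scale_def by (metis powr_gt_zero less_irrefl)
qed

context
  fixes \<beta> b e :: real
  assumes pos: "0 < \<beta>" "0 < b" "0 < e"
begin

lemma smooth_abs_powr_deriv:
  "((\<lambda>x. (smooth_abs e x + b) powr q) has_real_derivative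
    q * (smooth_abs e x + b) powr (q - 1) * (x / smooth_abs e x)) (at x)"
  using smooth_abs_pos[OF pos(3), of x] pos(2)
  by (auto intro!: derivative_eq_intros smooth_abs_deriv[OF pos(3)] DERIV_powr[THEN DERIV_cong] simp: field_simps)

private abbreviation "h \<equiv> smooth_abs e"
private abbreviation "V' \<equiv> \<lambda>x. profile_scale \<beta> * (- (2 / \<beta>)) * (h x + b) powr (- (2 / \<beta>) - 1) * (x / h x)"
private abbreviation "V'' \<equiv> \<lambda>x. profile_scale \<beta> * (2 / \<beta>) * (2 / \<beta> + 1) * (h x + b) powr (- (2 / \<beta>) - 2) * (x / h x)\<^sup>2
    - profile_scale \<beta> * (2 / \<beta>) * (h x + b) powr (- (2 / \<beta>) - 1) * (e\<^sup>2 / h x ^ 3)"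

lemma profile_deriv: "(profile \<beta> b e has_real_derivative V' x) (at x)"
  unfolding profile_def[abs_def]
  by (rule DERIV_cmult[OF smooth_abs_powr_deriv, THEN DERIV_cong]) simp

lemma profile_deriv2: "(V' has_real_derivative V'' x) (at x)"
proof -
  have ex: "- (2 / \<beta>) - 1 - 1 = - (2 / \<beta>) - 2" by simp
  have D: "(V' has_real_derivative
      (profile_scale \<beta> * (- (2 / \<beta>))) * ((- (2 / \<beta>) - 1) * (h x + b) powr (- (2 / \<beta>) - 1 - 1) * (x / h x)) * (x / h x)
      + (e\<^sup>2 / h x ^ 3) * ((profile_scale \<beta> * (- (2 / \<beta>))) * (h x + b) powr (- (2 / \<beta>) - 1))) (at x)"
    by (intro DERIV_mult DERIV_cmult smooth_abs_powr_deriv smooth_abs_deriv2[OF pos(3)])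
  \<comment> \<open>The powers are replaced by free variables, which leaves a polynomial
    identity.\<close>
  have id: "(a * (- q)) * ((- q - 1) * w * y) * y + z * (a * (- q) * v)
      = a * q * (q + 1) * w * y\<^sup>2 - a * q * v * z" for a q v w y z :: real
    by (simp add: power2_eq_square algebra_simps)
  show ?thesis by (rule DERIV_cong[OF D[unfolded ex] id])
qed

lemma source_eq: "source \<beta> b e x = profile \<beta> b e x powr (1 + \<beta>) - V'' x / 2"
proof -
  let ?a = "profile_scale \<beta>"
  have hx: "0 < h x" "0 < h x + b" using smooth_abs_pos[OF pos(3), of x] pos(2) by auto
  have "?a powr \<beta> = (2 / \<beta>) * (2 / \<beta> + 1) / 2"
    using pos(1) by (simp add: profile_scale_def powr_powr)
  then have a: "?a powr (1 + \<beta>) = ?a * ((2 / \<beta>) * (2 / \<beta> + 1) / 2)"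
    using profile_scale_pos[OF pos(1)] by (simp add: powr_add)
  \<comment> \<open>With q = 2/\<beta> one has q \<beta> = 2, so the nonlinear term carries the same
    power as the leading term of V''. This fixes the exponent of the profile.\<close>
  have exp: "- (2 / \<beta>) * (1 + \<beta>) = - (2 / \<beta>) - 2" using pos(1) by (simp add: field_simps)
  have "((h x + b) powr (- (2 / \<beta>))) powr (1 + \<beta>) = (h x + b) powr (- (2 / \<beta>) - 2)"
    by (simp only: powr_powr exp)
  then have V: "profile \<beta> b e x powr (1 + \<beta>)
      = ?a * ((2 / \<beta>) * (2 / \<beta> + 1) / 2) * (h x + b) powr (- (2 / \<beta>) - 2)"
    using profile_scale_pos[OF pos(1)] unfolding profile_def by (simp add: powr_mult a)
  have E: "e\<^sup>2 / h x ^ 2 = 1 - (x / h x)\<^sup>2"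
    using hx smooth_abs_sq[of e x] pos(3)
    by (simp add: power_divide divide_eq_eq eq_divide_eq right_diff_distrib left_diff_distrib)
  have id: "a * q * (q + 1) / 2 * w * (1 - y) + a * q / 2 * v * z
      = a * (q * (q + 1) / 2) * w - (a * q * (q + 1) * w * y - a * q * v * z) / 2" for a q v w y z :: real
    by (simp add: field_simps)
  show ?thesis unfolding V source_def E by (rule id)
qed

text \<open>With h = \<open>smooth_abs e x\<close>, the sum h + b is at least b, the modulus of x/h
  is at most 1, and e^2/h^3 is at most 1/e. \<open>B\<close> adds up the bounds of all terms because
  \<open>mild_solution_stationary\<close> asks for a common one. Its factor 1/e is harmless while e
  is fixed.\<close>

lemma profile_bounds:
  defines "B \<equiv> profile_scale \<beta> * b powr (- (2 / \<beta>))
    + profile_scale \<beta> * (2 / \<beta>) * b powr (- (2 / \<beta>) - 1)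
    + profile_scale \<beta> * (2 / \<beta>) * (2 / \<beta> + 1) * b powr (- (2 / \<beta>) - 2)
    + profile_scale \<beta> * (2 / \<beta>) * b powr (- (2 / \<beta>) - 1) * (1 / e)"
  shows "0 \<le> profile \<beta> b e x" "\<bar>profile \<beta> b e x\<bar> \<le> B" "\<bar>V' x\<bar> \<le> B" "\<bar>V'' x\<bar> \<le> B"
proof -
  let ?a = "profile_scale \<beta>" and ?q = "2 / \<beta>"
  have hx: "0 < h x" "b \<le> h x + b" using smooth_abs_pos[OF pos(3), of x] pos(2) by auto
  have q: "0 < ?q" using pos(1) by simp
  note a = profile_scale_pos[OF pos(1)]
  have pw: "(h x + b) powr (- ?q - c) \<le> b powr (- ?q - c)" if "0 \<le> c" for c
    using q that pos(2) hx by (intro powr_mono2') (auto intro: order_trans[of _ 0])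
  have xh: "\<bar>x / h x\<bar> \<le> 1" using smooth_abs_ge(2)[OF pos(3), of x] hx by (simp add: field_simps)
  then have xh2: "(x / h x)\<^sup>2 \<le> 1" by (simp add: abs_square_le_1)
  have eh: "e\<^sup>2 / h x ^ 3 \<le> 1 / e"
    using power_mono[OF smooth_abs_ge(1)[OF pos(3), of x], of 3] pos(3) hx
    by (simp add: field_simps power2_eq_square power3_eq_cube)
  let ?A0 = "?a * b powr (- ?q)" and ?A1 = "?a * ?q * b powr (- ?q - 1)"
    and ?A2 = "?a * ?q * (?q + 1) * b powr (- ?q - 2)"
  have nn: "0 \<le> ?A0" "0 \<le> ?A1" "0 \<le> ?A2" "0 \<le> ?A1 * (1 / e)"
    using a q pos(3) by auto
  show "0 \<le> profile \<beta> b e x" using a by (simp add: profile_def)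
  have "\<bar>profile \<beta> b e x\<bar> \<le> ?A0"
    using a pw[of 0] by (simp add: profile_def abs_mult)
  then show "\<bar>profile \<beta> b e x\<bar> \<le> B" using nn unfolding B_def by linarith
  have "\<bar>V' x\<bar> = ?a * ?q * (h x + b) powr (- ?q - 1) * \<bar>x / h x\<bar>"
    using a q by (simp add: abs_mult)
  also have "\<dots> \<le> ?A1 * 1"
    using a q by (intro mult_mono mult_left_mono pw xh) auto
  finally show "\<bar>V' x\<bar> \<le> B" using nn unfolding B_def by linarith
  have 1: "?a * ?q * (?q + 1) * (h x + b) powr (- ?q - 2) * (x / h x)\<^sup>2 \<le> ?A2 * 1"
    using a q by (intro mult_mono mult_left_mono pw xh2) auto
  have 2: "?a * ?q * (h x + b) powr (- ?q - 1) * (e\<^sup>2 / h x ^ 3) \<le> ?A1 * (1 / e)"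
    using a q hx by (intro mult_mono mult_left_mono pw eh) auto
  have 3: "0 \<le> ?a * ?q * (?q + 1) * (h x + b) powr (- ?q - 2) * (x / h x)\<^sup>2"
    "0 \<le> ?a * ?q * (h x + b) powr (- ?q - 1) * (e\<^sup>2 / h x ^ 3)"
    using a q hx by auto
  show "\<bar>V'' x\<bar> \<le> B" using 1 2 3 nn unfolding B_def by linarith
qed

lemma profile_continuous: "continuous_on UNIV (profile \<beta> b e)"
  using profile_deriv by (auto intro!: continuous_at_imp_continuous_on DERIV_isCont)

lemma source_nonneg: "0 \<le> source \<beta> b e x"
  using pos profile_scale_pos[OF pos(1)] smooth_abs_pos[OF pos(3), of x] by (simp add: source_def)

lemma source_continuous: "continuous_on UNIV (source \<beta> b e)"
  unfolding source_def[abs_def]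
  using smooth_abs_pos[OF pos(3)] pos(2)
  by (intro continuous_intros smooth_abs_continuous ballI) (auto simp: less_imp_neq[THEN not_sym] add_pos_pos)

text \<open>As the source is nonnegative, only an upper bound is to be found, and
  \<open>source_eq\<close> gives one from the bounds on the profile and its second
  derivative.\<close>

lemma source_bounded: "bounded (range (source \<beta> b e))"
proof -
  obtain B where B: "\<And>x. 0 \<le> profile \<beta> b e x" "\<And>x. \<bar>profile \<beta> b e x\<bar> \<le> B" "\<And>x. \<bar>V'' x\<bar> \<le> B"
    using profile_bounds by blast
  have "\<bar>source \<beta> b e x\<bar> \<le> B powr (1 + \<beta>) + B" for x
  proof -
    have pw: "profile \<beta> b e x powr (1 + \<beta>) \<le> B powr (1 + \<beta>)"
      using B(1,2)[of x] pos(1) by (intro powr_mono2) auto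
    have half: "- v / 2 \<le> B" if "\<bar>v\<bar> \<le> B" "0 \<le> B" for v
      using that by linarith
    have nh: "- V'' x / 2 \<le> B" using B(2)[of x] by (intro half B(3)) linarith
    have sum: "0 \<le> u - v / 2 \<Longrightarrow> u \<le> C \<Longrightarrow> - v / 2 \<le> B \<Longrightarrow> \<bar>u - v / 2\<bar> \<le> C + B" for u v C
      by linarith
    show ?thesis unfolding source_eq by (rule sum[OF source_nonneg[of x, unfolded source_eq] pw nh])
  qed
  then show ?thesis by (auto simp: bounded_iff)
qed

lemma profile_bounded: "bounded (range (profile \<beta> b e))"
  using profile_bounds(2) by (auto simp: bounded_iff)

lemma bounded_nonneg_borel_source: "bounded_nonneg_borel (source \<beta> b e)"
  unfolding bounded_nonneg_borel_def
  using source_bounded source_nonneg borel_measurable_continuous_onI[OF source_continuous] by simp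

lemma bounded_nonneg_borel_profile: "bounded_nonneg_borel (profile \<beta> b e)"
  unfolding bounded_nonneg_borel_def
  using profile_bounded profile_bounds(1) borel_measurable_continuous_onI[OF profile_continuous] by simp

lemma mild_solution_profile: "mild_solution \<beta> (profile \<beta> b e) (source \<beta> b e) (\<lambda>_. profile \<beta> b e)"
proof (rule mild_solution_stationary[OF profile_deriv profile_deriv2 _ profile_bounds(2-4,1) source_eq])
  show "continuous_on UNIV V''"
    using smooth_abs_pos[OF pos(3)] pos(2)
    by (intro continuous_intros smooth_abs_continuous ballI) (auto simp: less_imp_neq[THEN not_sym] add_pos_pos)
qed

end

section \<open>The sources as approximate point masses\<close>

section \<open>Convergence of the sources to a point mass\<close>

text \<open>The integrand is the second derivative of \<open>smooth_abs 1\<close>, so its integral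
  is the total change of slope, from -1 to 1.\<close>

lemma cauchy_kernel_integral:
  "integrable lborel (\<lambda>y. 1 / smooth_abs 1 y ^ 3)"
  "(\<integral>y. 1 / smooth_abs 1 y ^ 3 \<partial>lborel) = 2"
proof -
  let ?f = "\<lambda>y. 1 / smooth_abs 1 y ^ 3" and ?F = "\<lambda>y. y / smooth_abs 1 y"
  have F: "(?F has_real_derivative ?f y) (at y)" for y
    using smooth_abs_deriv2[of 1 y] by simp
  have pos: "0 < smooth_abs 1 y" for y by (rule smooth_abs_pos) simp
  have cont: "isCont ?f y" for y
    using pos[of y] unfolding smooth_abs_def[abs_def] by (intro continuous_intros) auto
  have nn: "AE y in lborel. - \<infinity> < ereal y \<longrightarrow> ereal y < \<infinity> \<longrightarrow> 0 \<le> ?f y"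
    using pos by (simp add: less_imp_le)
  have A: "((?F \<circ> real_of_ereal) \<longlongrightarrow> -1) (at_right (- \<infinity>))"
    unfolding ereal_tendsto_simps smooth_abs_def by real_asymp
  have B: "((?F \<circ> real_of_ereal) \<longlongrightarrow> 1) (at_left \<infinity>)"
    unfolding ereal_tendsto_simps smooth_abs_def by real_asymp
  note * = interval_integral_FTC_nonneg[where a = "- \<infinity>" and b = \<infinity>, OF _ F cont nn A B]
  show "integrable lborel ?f"
    using *(1) by (simp add: set_integrable_def einterval_def)
  show "(\<integral>y. ?f y \<partial>lborel) = 2"
    using *(2) by (simp add: interval_lebesgue_integral_def set_lebesgue_integral_def einterval_def)
qed

text \<open>The source is split in three. \<open>?A\<close> is its first summand, whose factor
  e^2/h^2 is at most 1 and tends to 0 off the origin. The second summand is of order e^2 outside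
  [-1, 1] (\<open>?B\<close>), while inside (\<open>?D\<close>) its factor e^2/h^3 is a peak of
  width e whose integral over the line is 2. The cut uses integrability of \<open>l\<close> far away
  and its continuity, hence boundedness, near 0.\<close>

lemma source_tendsto:
  fixes \<beta> b :: real and e :: "nat \<Rightarrow> real" and l :: "real \<Rightarrow> real"
  assumes pos: "0 < \<beta>" "0 < b"
    and e: "\<And>n. 0 < e n" "\<And>n. e n \<le> 1" "e \<longlonglongrightarrow> 0"
    and l: "continuous_on UNIV l" "integrable lborel l"
  shows "(\<lambda>n. \<integral>x. source \<beta> b (e n) x * l x \<partial>lborel)
    \<longlonglongrightarrow> profile_scale \<beta> * (2 / \<beta>) * b powr (- (2 / \<beta>) - 1) * l 0"
proof -
  define q where "q = 2 / \<beta>"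
  define C1 where "C1 = profile_scale \<beta> * q * (q + 1) / 2"
  define C2 where "C2 = profile_scale \<beta> * q / 2"
  let ?h = "\<lambda>n x. smooth_abs (e n) x"
  let ?p = "\<lambda>r n x. (?h n x + b) powr (- q - r)"
  have q: "0 < q" using pos by (simp add: q_def)
  have h_pos: "0 < ?h n x" for n x using smooth_abs_pos[OF e(1)] .
  have hb: "0 < ?h n x + b" for n x using h_pos[of n x] pos(2) by simp
  have p_le: "\<bar>?p r n x\<bar> \<le> b powr (- q - r)" if "0 \<le> r" for r n x
    using q that pos(2) h_pos[of n x] by (auto intro!: powr_mono2' intro: order_trans[of _ 0])
  have h_ge: "e n \<le> ?h n x" "\<bar>x\<bar> \<le> ?h n x" for n x using smooth_abs_ge[OF e(1)] by auto
  have h_lim: "(\<lambda>n. ?h n x) \<longlonglongrightarrow> \<bar>x\<bar>" for x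
  proof -
    have "(\<lambda>n. sqrt (x\<^sup>2 + (e n)\<^sup>2)) \<longlonglongrightarrow> sqrt (x\<^sup>2 + 0\<^sup>2)"
      by (intro tendsto_intros e)
    then show ?thesis by (simp add: smooth_abs_def)
  qed
  note h_cont = smooth_abs_continuous
  have [measurable]: "smooth_abs (e n) \<in> borel_measurable borel" for n
    using h_cont by (rule borel_measurable_continuous_onI)
  have l_meas [measurable]: "l \<in> borel_measurable borel"
    using l(1) by (rule borel_measurable_continuous_onI)
  have l_abs: "integrable lborel (\<lambda>x. \<bar>l x\<bar>)" using l(2) by simp

  let ?A = "\<lambda>n x. C1 * ?p 2 n x * ((e n)\<^sup>2 / ?h n x ^ 2) * l x"
  let ?B = "\<lambda>n x. indicator (- {-1..1}) x * (C2 * ?p 1 n x * ((e n)\<^sup>2 / ?h n x ^ 3) * l x)"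
  let ?D = "\<lambda>n x. indicator {-1..1} x * (C2 * ?p 1 n x * ((e n)\<^sup>2 / ?h n x ^ 3) * l x)"
  let ?k = "\<lambda>y. 1 / smooth_abs 1 y ^ 3"
  let ?E = "\<lambda>n y. indicator {-1..1} (e n * y) * (C2 * ?p 1 n (e n * y) * ?k y * l (e n * y))"

  have ratio2: "\<bar>(e n)\<^sup>2 / ?h n x ^ 2\<bar> \<le> 1" for n x
    using power_mono[OF h_ge(1)[of n x], of 2] e(1)[of n] h_pos[of n x] by simp
  have A_bound: "\<bar>?A n x\<bar> \<le> \<bar>C1\<bar> * b powr (- q - 2) * \<bar>l x\<bar>" for n x
  proof -
    have "\<bar>?A n x\<bar> = \<bar>C1\<bar> * \<bar>?p 2 n x\<bar> * \<bar>(e n)\<^sup>2 / ?h n x ^ 2\<bar> * \<bar>l x\<bar>"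
      by (simp only: abs_mult)
    also have "\<dots> \<le> \<bar>C1\<bar> * b powr (- q - 2) * 1 * \<bar>l x\<bar>"
      by (intro mult_mono p_le ratio2) auto
    finally show ?thesis by simp
  qed
  have A_int: "integrable lborel (?A n)" for n
    by (rule Bochner_Integration.integrable_bound[OF integrable_mult_right[OF l_abs, of "\<bar>C1\<bar> * b powr (- q - 2)"]])
       (measurable, intro AE_I2, unfold real_norm_def, rule order_trans[OF A_bound abs_ge_self])
  have A_lim: "(\<lambda>n. \<integral>x. ?A n x \<partial>lborel) \<longlonglongrightarrow> (\<integral>x. 0 \<partial>(lborel :: real measure))"
  proof (rule integral_dominated_convergence)
    show "integrable lborel (\<lambda>x. \<bar>C1\<bar> * b powr (- q - 2) * \<bar>l x\<bar>)"
      using l_abs by (rule integrable_mult_right)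
    show "AE x in lborel. norm (?A n x) \<le> \<bar>C1\<bar> * b powr (- q - 2) * \<bar>l x\<bar>" for n
      by (intro AE_I2, unfold real_norm_def, rule A_bound)
    show "AE x in lborel. (\<lambda>n. ?A n x) \<longlonglongrightarrow> 0"
      \<comment> \<open>The origin is left out because e^2/h^2 equals 1 there for every n.\<close>
      using AE_lborel_singleton[of 0]
    proof eventually_elim
      case (elim x)
      have "(\<lambda>n. ?A n x) \<longlonglongrightarrow> C1 * (\<bar>x\<bar> + b) powr (- q - 2) * (0\<^sup>2 / \<bar>x\<bar> ^ 2) * l x"
        using elim pos(2) by (intro tendsto_intros h_lim e(3)) auto
      then show ?case by simp
    qed
  qed simp_all

  have ratio3: "\<bar>(e n)\<^sup>2 / ?h n x ^ 3\<bar> \<le> (e n)\<^sup>2" if "1 < \<bar>x\<bar>" for n x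
  proof -
    have "1 \<le> ?h n x" using h_ge(2)[of x n] that by simp
    then have "1 \<le> ?h n x ^ 3" by simp
    then show ?thesis using h_pos[of n x] mult_left_mono[of 1 "?h n x ^ 3" "(e n)\<^sup>2"]
      by (simp add: divide_le_eq)
  qed
  have e_sq: "(e n)\<^sup>2 \<le> 1" for n using e(1,2)[of n] by (simp add: power_le_one)
  have B_bound: "\<bar>?B n x\<bar> \<le> \<bar>C2\<bar> * b powr (- q - 1) * (e n)\<^sup>2 * \<bar>l x\<bar>" for n x
  proof (cases "\<bar>x\<bar> \<le> 1")
    case False
    have "\<bar>?B n x\<bar> \<le> \<bar>C2\<bar> * \<bar>?p 1 n x\<bar> * \<bar>(e n)\<^sup>2 / ?h n x ^ 3\<bar> * \<bar>l x\<bar>"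
      by (simp add: abs_mult split: split_indicator)
    also have "\<dots> \<le> \<bar>C2\<bar> * b powr (- q - 1) * (e n)\<^sup>2 * \<bar>l x\<bar>"
      using False by (intro mult_mono p_le ratio3) auto
    finally show ?thesis .
  qed (auto split: split_indicator)
  have B_bound1: "\<bar>?B n x\<bar> \<le> \<bar>C2\<bar> * b powr (- q - 1) * \<bar>l x\<bar>" for n x
  proof -
    have "\<bar>C2\<bar> * b powr (- q - 1) * (e n)\<^sup>2 * \<bar>l x\<bar> \<le> \<bar>C2\<bar> * b powr (- q - 1) * 1 * \<bar>l x\<bar>"
      by (intro mult_right_mono mult_left_mono e_sq) auto
    then show ?thesis using B_bound[of x n] by simp
  qed
  have B_int: "integrable lborel (?B n)" for n
    by (rule Bochner_Integration.integrable_bound[OF integrable_mult_right[OF l_abs, of "\<bar>C2\<bar> * b powr (- q - 1)"]])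
       (measurable, intro AE_I2, unfold real_norm_def, rule order_trans[OF B_bound1 abs_ge_self])
  have B_lim: "(\<lambda>n. \<integral>x. ?B n x \<partial>lborel) \<longlonglongrightarrow> (\<integral>x. 0 \<partial>(lborel :: real measure))"
  proof (rule integral_dominated_convergence)
    show "integrable lborel (\<lambda>x. \<bar>C2\<bar> * b powr (- q - 1) * \<bar>l x\<bar>)"
      using l_abs by (rule integrable_mult_right)
    show "AE x in lborel. norm (?B n x) \<le> \<bar>C2\<bar> * b powr (- q - 1) * \<bar>l x\<bar>" for n
      by (intro AE_I2, unfold real_norm_def, rule B_bound1)
    show "AE x in lborel. (\<lambda>n. ?B n x) \<longlonglongrightarrow> 0"
    proof (rule AE_I2, rule Lim_null_comparison)
      fix x
      show "\<forall>\<^sub>F n in sequentially. norm (?B n x) \<le> \<bar>C2\<bar> * b powr (- q - 1) * (e n)\<^sup>2 * \<bar>l x\<bar>"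
        using B_bound by simp
      have "(\<lambda>n. \<bar>C2\<bar> * b powr (- q - 1) * (e n)\<^sup>2 * \<bar>l x\<bar>) \<longlonglongrightarrow> \<bar>C2\<bar> * b powr (- q - 1) * 0\<^sup>2 * \<bar>l x\<bar>"
        by (intro tendsto_intros e)
      then show "(\<lambda>n. \<bar>C2\<bar> * b powr (- q - 1) * (e n)\<^sup>2 * \<bar>l x\<bar>) \<longlonglongrightarrow> 0" by simp
    qed
  qed simp_all

  have D_int: "integrable lborel (?D n)" for n
  proof -
    have "continuous_on {-1..1} (\<lambda>x. C2 * ?p 1 n x * ((e n)\<^sup>2 / ?h n x ^ 3) * l x)"
      using h_pos hb
      by (intro continuous_intros continuous_on_subset[OF h_cont] continuous_on_subset[OF l(1)] ballI)
         (auto simp: less_imp_neq[THEN not_sym])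
    from borel_integrable_atLeastAtMost'[OF this] show ?thesis by (simp add: set_integrable_def)
  qed
  \<comment> \<open>Substituting x = e y turns the moving peak e^2/h^3 into the fixed integrable
    kernel \<open>?k\<close>, which then serves as majorant.\<close>
  have DE: "(\<integral>x. ?D n x \<partial>lborel) = (\<integral>y. ?E n y \<partial>lborel)" for n
  proof -
    have "(\<integral>x. ?D n x \<partial>lborel) = \<bar>e n\<bar> *\<^sub>R (\<integral>y. ?D n (0 + e n * y) \<partial>lborel)"
      using e(1)[of n] by (intro lborel_integral_real_affine) simp
    also have "\<dots> = (\<integral>y. e n * ?D n (e n * y) \<partial>lborel)"
      by (simp only: real_scaleR_def abs_of_pos[OF e(1)] Bochner_Integration.integral_mult_right_zero add_0)
    also have "\<dots> = (\<integral>y. ?E n y \<partial>lborel)"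
    proof (rule Bochner_Integration.integral_cong[OF refl])
      fix y
      have "?h n (e n * y) = sqrt ((e n)\<^sup>2 * (y\<^sup>2 + 1))"
        by (simp add: smooth_abs_def power_mult_distrib algebra_simps)
      also have "\<dots> = e n * smooth_abs 1 y"
        using e(1)[of n] by (simp add: real_sqrt_mult smooth_abs_def)
      finally have h: "?h n (e n * y) = e n * smooth_abs 1 y" .
      have k: "e n * ((e n)\<^sup>2 / ?h n (e n * y) ^ 3) = ?k y"
        using e(1)[of n] unfolding h by (simp add: power_mult_distrib power2_eq_square power3_eq_cube)
      have "e n * ?D n (e n * y) = indicator {-1..1} (e n * y) *
          (C2 * ?p 1 n (e n * y) * (e n * ((e n)\<^sup>2 / ?h n (e n * y) ^ 3)) * l (e n * y))"
        by (simp add: mult_ac)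
      then show "e n * ?D n (e n * y) = ?E n y" unfolding k .
    qed
    finally show ?thesis .
  qed
  obtain K where K: "\<And>x. x \<in> {-1..1} \<Longrightarrow> \<bar>l x\<bar> \<le> K"
  proof -
    have "compact (l ` {-1..1})"
      by (intro compact_continuous_image continuous_on_subset[OF l(1)]) auto
    then show ?thesis using that by (force dest!: compact_imp_bounded simp: bounded_iff)
  qed
  have k_pos: "0 < smooth_abs 1 y" for y by (rule smooth_abs_pos) simp
  have D_lim: "(\<lambda>n. \<integral>x. ?D n x \<partial>lborel) \<longlonglongrightarrow> (\<integral>y. C2 * b powr (- q - 1) * l 0 * ?k y \<partial>lborel)"
    unfolding DE
  proof (rule integral_dominated_convergence)
    show "integrable lborel (\<lambda>y. \<bar>C2\<bar> * b powr (- q - 1) * K * ?k y)"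
      using cauchy_kernel_integral(1) by (rule integrable_mult_right)
    have 0: "0 \<le> K" using K[of 0] by simp
    have "\<bar>?E n y\<bar> \<le> \<bar>C2\<bar> * b powr (- q - 1) * K * ?k y" for n y
    proof (cases "e n * y \<in> {-1..1}")
      case True
      then have "\<bar>?E n y\<bar> = \<bar>C2\<bar> * \<bar>?p 1 n (e n * y)\<bar> * \<bar>?k y\<bar> * \<bar>l (e n * y)\<bar>"
        by (simp add: abs_mult)
      also have "\<dots> \<le> \<bar>C2\<bar> * b powr (- q - 1) * \<bar>?k y\<bar> * K"
        using True by (intro mult_mono p_le K) auto
      finally show ?thesis using k_pos[of y] by (simp add: mult_ac)
    qed (use 0 k_pos[of y] in auto)
    then show "AE y in lborel. norm (?E n y) \<le> \<bar>C2\<bar> * b powr (- q - 1) * K * ?k y" for n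
      by simp
    show "AE y in lborel. (\<lambda>n. ?E n y) \<longlonglongrightarrow> C2 * b powr (- q - 1) * l 0 * ?k y"
    proof (rule AE_I2)
      fix y
      have ey: "(\<lambda>n. e n * y) \<longlonglongrightarrow> 0" using e(3) by (rule tendsto_mult_left_zero)
      have "\<forall>\<^sub>F n in sequentially. \<bar>e n * y\<bar> < 1"
        using tendsto_rabs_zero[OF ey] by (rule order_tendstoD) simp
      \<comment> \<open>For fixed y the cut-off is eventually inactive.\<close>
      then have ind: "\<forall>\<^sub>F n in sequentially. C2 * ?p 1 n (e n * y) * ?k y * l (e n * y) = ?E n y"
        by eventually_elim (simp add: abs_less_iff)
      have "(\<lambda>n. sqrt ((e n * y)\<^sup>2 + (e n)\<^sup>2)) \<longlonglongrightarrow> sqrt (0\<^sup>2 + 0\<^sup>2)"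
        by (intro tendsto_intros e ey)
      then have h0: "(\<lambda>n. ?h n (e n * y)) \<longlonglongrightarrow> 0" by (simp add: smooth_abs_def)
      have "isCont l 0" using l(1) by (simp add: continuous_on_eq_continuous_at)
      then have "(\<lambda>n. l (e n * y)) \<longlonglongrightarrow> l 0" using ey by (rule isCont_tendsto_compose)
      then have "(\<lambda>n. C2 * ?p 1 n (e n * y) * ?k y * l (e n * y))
          \<longlonglongrightarrow> C2 * (0 + b) powr (- q - 1) * ?k y * l 0"
        using pos(2) by (intro tendsto_intros h0) auto
      from Lim_transform_eventually[OF this ind]
      show "(\<lambda>n. ?E n y) \<longlonglongrightarrow> C2 * b powr (- q - 1) * l 0 * ?k y" by (simp add: mult_ac)
    qed
  qed (simp_all add: smooth_abs_def)
  have "(\<integral>x. source \<beta> b (e n) x * l x \<partial>lborel)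
      = (\<integral>x. ?A n x \<partial>lborel) + ((\<integral>x. ?B n x \<partial>lborel) + (\<integral>x. ?D n x \<partial>lborel))" for n
  proof -
    have "source \<beta> b (e n) x * l x = ?A n x + (?B n x + ?D n x)" for x
      unfolding source_def C1_def C2_def q_def
      by (auto simp: distrib_right split: split_indicator)
    then show ?thesis using A_int B_int D_int by simp
  qed
  moreover have "(\<lambda>n. (\<integral>x. ?A n x \<partial>lborel) + ((\<integral>x. ?B n x \<partial>lborel) + (\<integral>x. ?D n x \<partial>lborel)))
      \<longlonglongrightarrow> (\<integral>x. 0 \<partial>(lborel :: real measure)) + ((\<integral>x. 0 \<partial>(lborel :: real measure)) + (\<integral>y. C2 * b powr (- q - 1) * l 0 * ?k y \<partial>lborel))"
    by (intro tendsto_add A_lim B_lim D_lim)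
  moreover have "(\<integral>y. C2 * b powr (- q - 1) * l 0 * ?k y \<partial>lborel)
      = profile_scale \<beta> * (2 / \<beta>) * b powr (- (2 / \<beta>) - 1) * l 0"
    by (simp only: Bochner_Integration.integral_mult_right_zero cauchy_kernel_integral(2)) (simp add: C2_def q_def)
  ultimately show ?thesis by simp
qed

lemma profile_tendsto:
  assumes "0 < b" "e \<longlonglongrightarrow> 0"
  shows "(\<lambda>n. profile \<beta> b (e n) 0) \<longlonglongrightarrow> profile_scale \<beta> * b powr (- (2 / \<beta>))"
proof -
  have "(\<lambda>n. profile_scale \<beta> * (sqrt (0\<^sup>2 + (e n)\<^sup>2) + b) powr (- (2 / \<beta>)))
      \<longlonglongrightarrow> profile_scale \<beta> * (sqrt (0\<^sup>2 + 0\<^sup>2) + b) powr (- (2 / \<beta>))"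
    using assms(1) by (intro tendsto_intros assms(2)) auto
  then show ?thesis by (simp add: profile_def smooth_abs_def)
qed

section \<open>Almost sure extinction in finite time\<close>

section \<open>Extinction\<close>

lemma measurable_mass: "(\<lambda>\<mu>. measure \<mu> UNIV) \<in> borel_measurable borel_finite_measures"
proof -
  have "(\<lambda>\<mu>. \<integral>x. (1::real) \<partial>\<mu>) \<in> borel_measurable borel_finite_measures"
    by (rule measurable_integral_finite_measures) auto
  then show ?thesis
    by (rule measurable_cong[THEN iffD1, rotated])
       (auto simp: space_borel_finite_measures finite_measuresD(3))
qed

context stable_super_brownian_motion
begin

abbreviation mass :: "real \<Rightarrow> 'w \<Rightarrow> real" where
  "mass t \<omega> \<equiv> measure (X t \<omega>) UNIV"

lemma X_finite_measures: "\<omega> \<in> space A \<Longrightarrow> 0 \<le> t \<Longrightarrow> X t \<omega> \<in> finite_measures"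
  using cadlag_paths cadlag_finite_measures by blast

lemma P_space:
  assumes "\<mu> \<in> finite_measures"
  shows "prob_space (P \<mu>)" "sets (P \<mu>) = sets A" "space (P \<mu>) = space A"
proof -
  have "P \<mu> \<in> space (prob_algebra A)"
    using measurable_space[OF kernel] assms by (simp add: space_borel_finite_measures)
  then show "prob_space (P \<mu>)" and *: "sets (P \<mu>) = sets A"
    by (auto simp: space_prob_algebra)
  show "space (P \<mu>) = space A" using * by (rule sets_eq_imp_space_eq)
qed

lemma measurable_mass_F: "0 \<le> r \<Longrightarrow> r \<le> t \<Longrightarrow> mass r \<in> borel_measurable (F t)"
  using sets_F_mono[of r t] space_F[of r] space_F[of t]
  by (intro measurable_from_subalg[OF _ measurable_compose[OF adapted measurable_mass], of _ r])
     (auto simp: subalgebra_def)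

lemma measurable_F_P:
  assumes "\<mu> \<in> finite_measures" "f \<in> borel_measurable (F t)"
  shows "f \<in> borel_measurable (P \<mu>)"
  using sets_filtration[of t] P_space[OF assms(1)] space_F[of t]
  by (intro measurable_from_subalg[OF _ assms(2)]) (auto simp: subalgebra_def)

lemma laplace_mass:
  assumes "0 < \<beta>" "\<mu> \<in> finite_measures" "0 < \<theta>" "0 \<le> t"
  shows "(\<integral>\<omega>. exp (- \<theta> * mass t \<omega>) \<partial>P \<mu>)
    = exp (- ((\<theta> powr (- \<beta>) + \<beta> * t) powr (- (1 / \<beta>)) * measure \<mu> UNIV))"
proof -
  have "(\<integral>\<omega>. exp (- (\<integral>x. \<theta> \<partial>X t \<omega>) - (LBINT s:{0..t}. \<integral>x. 0 \<partial>X s \<omega>)) \<partial>P \<mu>)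
      = exp (- (\<integral>x. (\<theta> powr (- \<beta>) + \<beta> * t) powr (- (1 / \<beta>)) \<partial>\<mu>))"
    using assms by (intro log_laplace mild_solution_constant) (auto simp: bounded_nonneg_borel_def)
  moreover have "(\<integral>\<omega>. exp (- (\<integral>x. \<theta> \<partial>X t \<omega>) - (LBINT s:{0..t}. \<integral>x. 0 \<partial>X s \<omega>)) \<partial>P \<mu>)
      = (\<integral>\<omega>. exp (- \<theta> * mass t \<omega>) \<partial>P \<mu>)"
    using assms P_space(3)[OF assms(2)]
    by (intro Bochner_Integration.integral_cong) (auto simp: finite_measuresD(3)[OF X_finite_measures])
  ultimately show ?thesis using finite_measuresD(3)[OF assms(2)] by (simp add: mult.commute)
qed

text \<open>As \<theta> tends to infinity in \<open>laplace_mass\<close>, the Laplace transform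
  decreases to the probability of zero mass at time n. Dropping \<theta>^(-\<beta>) from the
  exponent bounds this probability below by \<open>?c n\<close>, which tends to 1.\<close>

lemma AE_extinct:
  assumes \<beta>: "0 < \<beta>" and \<mu>: "\<mu> \<in> finite_measures"
  shows "AE \<omega> in P \<mu>. \<exists>n::nat. mass (real n) \<omega> = 0"
proof -
  interpret prob_space "P \<mu>" using P_space[OF \<mu>] by simp
  have [measurable]: "mass (real n) \<in> borel_measurable (P \<mu>)" for n
    using measurable_F_P[OF \<mu> measurable_mass_F[of "real n"]] by auto
  let ?c = "\<lambda>n::nat. exp (- ((\<beta> * real n) powr (- (1 / \<beta>)) * measure \<mu> UNIV))"
  let ?E = "{\<omega> \<in> space (P \<mu>). \<exists>n::nat. mass (real n) \<omega> = 0}"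
  \<comment> \<open>At n = 0 the convention \<open>0 powr y = 0\<close> would make
    \<open>?c 0\<close> equal to 1, so the bound is claimed only for positive n.\<close>
  have "?c n \<le> prob ?E" if n: "0 < n" for n
  proof -
    have lim: "(\<lambda>k. \<integral>\<omega>. exp (- real (Suc k) * mass n \<omega>) \<partial>P \<mu>)
        \<longlonglongrightarrow> (\<integral>\<omega>. indicator {\<omega> \<in> space (P \<mu>). mass (real n) \<omega> = 0} \<omega> \<partial>P \<mu>)"
    proof (rule integral_dominated_convergence[where w = "\<lambda>_. 1"])
      show "AE \<omega> in P \<mu>. (\<lambda>k. exp (- real (Suc k) * mass n \<omega>))
          \<longlonglongrightarrow> indicator {\<omega> \<in> space (P \<mu>). mass (real n) \<omega> = 0} \<omega>"
      proof (rule AE_I2)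
        fix \<omega> assume \<omega>: "\<omega> \<in> space (P \<mu>)"
        show "(\<lambda>k. exp (- real (Suc k) * mass n \<omega>))
          \<longlonglongrightarrow> indicator {\<omega> \<in> space (P \<mu>). mass (real n) \<omega> = 0} \<omega>"
        proof (cases "mass n \<omega> = 0")
          case False
          then have "0 < mass n \<omega>" by (simp add: zero_less_measure_iff)
          then have "(\<lambda>k. exp (- real (Suc k) * mass n \<omega>)) \<longlonglongrightarrow> 0"
            by real_asymp
          then show ?thesis using False by simp
        qed (use \<omega> in simp)
      qed
      have "exp (- real (Suc k) * mass n \<omega>) \<le> 1" for k \<omega>
        by (simp only: exp_le_one_iff minus_mult_left[symmetric] neg_le_0_iff_le) simp
      then show "AE \<omega> in P \<mu>. norm (exp (- real (Suc k) * mass n \<omega>)) \<le> 1" for k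
        by (intro AE_I2) (simp only: real_norm_def abs_exp_cancel)
    qed auto
    have "?c n \<le> (\<integral>\<omega>. exp (- real (Suc k) * mass n \<omega>) \<partial>P \<mu>)" for k
    proof -
      have "(real (Suc k) powr (- \<beta>) + \<beta> * real n) powr (- (1 / \<beta>)) \<le> (\<beta> * real n) powr (- (1 / \<beta>))"
        using n \<beta> by (intro powr_mono2') auto
      then show ?thesis
        using \<beta> \<mu> by (subst laplace_mass) (auto intro!: mult_right_mono)
    qed
    then have "?c n \<le> (\<integral>\<omega>. indicator {\<omega> \<in> space (P \<mu>). mass (real n) \<omega> = 0} \<omega> \<partial>P \<mu>)"
      by (intro LIMSEQ_le_const[OF lim]) auto
    also have "\<dots> \<le> prob ?E"
      by (simp, intro finite_measure_mono) auto
    finally show ?thesis .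
  qed
  moreover have "?c \<longlonglongrightarrow> 1"
    using \<beta> by real_asymp
  ultimately have "1 \<le> prob ?E"
    by (intro LIMSEQ_le_const2[of ?c]) (auto intro!: exI[of _ 1])
  then have "prob ?E = 1" by (simp add: measure_ge_1_iff)
  then show ?thesis by (subst (asm) prob_Collect_eq_1) auto
qed

section \<open>Absorption of the mass at zero, by a maximal inequality\<close>

text \<open>Given the past up to time r, the expectation of 1 - exp(- mass at t) is 1 - exp(- v m),
  where m is the mass at r and v is the exponent started from \<theta> = 1 and run for time t - r.
  It is at most v m, the exponent decreases in time so that v is at most 1, and m is at most
  \<delta> on \<open>B\<close>.\<close>

lemma absorption_step:
  assumes \<beta>: "0 < \<beta>" and \<mu>: "\<mu> \<in> finite_measures" and r: "0 \<le> r" "r \<le> t"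
    and B: "B \<in> sets (F r)" "\<And>\<omega>. \<omega> \<in> B \<Longrightarrow> mass r \<omega> \<le> \<delta>"
  shows "(\<integral>\<omega>. indicator B \<omega> * (1 - exp (- mass t \<omega>)) \<partial>P \<mu>) \<le> \<delta> * measure (P \<mu>) B"
proof -
  interpret prob_space "P \<mu>" using P_space[OF \<mu>] by simp
  \<comment> \<open>A deterministic time: the strong Markov property enters only through such
    times.\<close>
  define T where "T = (\<lambda>_ :: 'w. r)"
  have T: "stopping_time F T" unfolding T_def by (rule stopping_time_const)
  have B_space: "B \<subseteq> space A" using sets.sets_into_space[OF B(1)] space_F by simp
  have B_pre: "B \<in> sets (pre_sigma T)"
  proof (rule sets_pre_sigmaI[OF T])
    fix s
    show "{\<omega> \<in> B. T \<omega> \<le> s} \<in> sets (F s)"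
      using sets_F_mono[of r s] B(1) by (cases "r \<le> s") (auto simp: T_def)
  qed
  have "subalgebra (P \<mu>) (pre_sigma T)"
  proof (unfold subalgebra_def, intro conjI subsetI)
    show "space (pre_sigma T) = space (P \<mu>)" using P_space[OF \<mu>] by (simp add: space_pre_sigma)
    fix C assume "C \<in> sets (pre_sigma T)"
    from sets_pre_sigmaD[OF T this, of r] have "C \<in> sets (F r)" by (simp add: T_def)
    then show "C \<in> sets (P \<mu>)" using sets_filtration P_space[OF \<mu>] by auto
  qed
  then interpret finite_measure_subalgebra "P \<mu>" "pre_sigma T"
    by unfold_locales
  have B_P [measurable]: "B \<in> sets (P \<mu>)" using B(1) sets_filtration P_space[OF \<mu>] by auto
  have [measurable]: "mass t \<in> borel_measurable (P \<mu>)"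
    using measurable_F_P[OF \<mu> measurable_mass_F[of t]] r by auto
  let ?g = "\<lambda>\<nu> :: real measure. 1 - exp (- measure \<nu> UNIV)"
  have g01: "0 \<le> ?g \<nu>" "?g \<nu> \<le> 1" for \<nu> by auto
  have g_int: "integrable (P \<mu>) (\<lambda>\<omega>. ?g (X t \<omega>))"
    by (rule integrable_const_bound[where B = 1]) auto
  have markov: "AE \<omega> in P \<mu>. real_cond_exp (P \<mu>) (pre_sigma T) (\<lambda>\<omega>. ?g (X (T \<omega> + (t - r)) \<omega>)) \<omega>
      = (\<integral>\<omega>'. ?g (X (t - r) \<omega>') \<partial>P (X (T \<omega>) \<omega>))"
  proof (rule strong_markov[OF \<mu> T])
    show "?g \<in> borel_measurable borel_finite_measures" using measurable_mass by measurable
    show "bounded (?g ` finite_measures)" using g01 by (auto simp: bounded_iff intro!: exI[of _ 1])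
  qed (use r in \<open>auto simp: T_def\<close>)
  have inner: "(\<integral>\<omega>'. ?g (X (t - r) \<omega>') \<partial>P (X r \<omega>)) \<le> \<delta>" if "\<omega> \<in> B" for \<omega>
  proof -
    have \<nu>: "X r \<omega> \<in> finite_measures" using that B_space r(1) X_finite_measures by auto
    interpret \<nu>: prob_space "P (X r \<omega>)" using P_space[OF \<nu>] by simp
    let ?v = "(1 powr (- \<beta>) + \<beta> * (t - r)) powr (- (1 / \<beta>))"
    have [measurable]: "mass (t - r) \<in> borel_measurable (P (X r \<omega>))"
      using measurable_F_P[OF \<nu> measurable_mass_F[of "t - r" "t - r"]] r by simp
    have "integrable (P (X r \<omega>)) (\<lambda>\<omega>'. exp (- mass (t - r) \<omega>'))"
      by (intro \<nu>.integrable_const_bound[where B = 1]) auto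
    then have "(\<integral>\<omega>'. ?g (X (t - r) \<omega>') \<partial>P (X r \<omega>)) = 1 - (\<integral>\<omega>'. exp (- mass (t - r) \<omega>') \<partial>P (X r \<omega>))"
      by (simp add: \<nu>.prob_space)
    also have "\<dots> = 1 - exp (- (?v * mass r \<omega>))"
      using laplace_mass[OF \<beta> \<nu>, of 1 "t - r"] r by simp
    also have "\<dots> \<le> ?v * mass r \<omega>"
      using exp_ge_add_one_self[of "- (?v * mass r \<omega>)"] by simp
    also have "\<dots> \<le> 1 * mass r \<omega>"
    proof (rule mult_right_mono)
      have "?v \<le> 1 powr (- (1 / \<beta>))" using \<beta> r by (intro powr_mono2') auto
      then show "?v \<le> 1" by simp
    qed simp
    finally show ?thesis using B(2)[OF that] by simp
  qed
  have "(\<integral>\<omega>. indicator B \<omega> * (1 - exp (- mass t \<omega>)) \<partial>P \<mu>) = (\<integral>\<omega>\<in>B. ?g (X t \<omega>) \<partial>P \<mu>)"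
    by (simp add: set_lebesgue_integral_def)
  also have "\<dots> = (\<integral>\<omega>\<in>B. real_cond_exp (P \<mu>) (pre_sigma T) (\<lambda>\<omega>. ?g (X t \<omega>)) \<omega> \<partial>P \<mu>)"
    by (rule real_cond_exp_intA[OF g_int B_pre])
  also have "\<dots> \<le> (\<integral>\<omega>. indicator B \<omega> * \<delta> \<partial>P \<mu>)"
    unfolding set_lebesgue_integral_def
  proof (rule integral_mono_AE)
    show "integrable (P \<mu>) (\<lambda>\<omega>. indicator B \<omega> *\<^sub>R real_cond_exp (P \<mu>) (pre_sigma T) (\<lambda>\<omega>. ?g (X t \<omega>)) \<omega>)"
      using real_cond_exp_int(1)[OF g_int] by (intro integrable_mult_indicator B_P)
    show "integrable (P \<mu>) (\<lambda>\<omega>. indicator B \<omega> * \<delta>)"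
      by (intro integrable_mult_left integrable_real_indicator B_P) (simp add: emeasure_eq_measure)
    show "AE \<omega> in P \<mu>. indicator B \<omega> *\<^sub>R real_cond_exp (P \<mu>) (pre_sigma T) (\<lambda>\<omega>. ?g (X t \<omega>)) \<omega>
        \<le> indicator B \<omega> * \<delta>"
      using markov by eventually_elim (use inner in \<open>auto simp: T_def split: split_indicator\<close>)
  qed
  also have "\<dots> = \<delta> * prob B" by simp
  finally show ?thesis .
qed

text \<open>The event is split according to the first time in \<open>R\<close> at which the mass is
  at most \<delta>, and \<open>absorption_step\<close> bounds each piece. The induction adds times
  in increasing order, so the new piece, whose first such time is \<open>b\<close>, belongs to
  \<open>F b\<close>. Keeping the probability on the right lets the disjoint pieces add up with no
  factor counting the times.\<close>

lemma absorption_finite: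
  fixes \<delta> :: real
  assumes \<beta>: "0 < \<beta>" and \<mu>: "\<mu> \<in> finite_measures"
    and R: "finite R" "\<And>r. r \<in> R \<Longrightarrow> 0 \<le> r \<and> r \<le> t" and t: "0 \<le> t"
  defines "G \<equiv> \<lambda>R. {\<omega> \<in> space A. \<exists>r\<in>R. mass r \<omega> \<le> \<delta>}"
  shows "(\<integral>\<omega>. indicator (G R) \<omega> * (1 - exp (- mass t \<omega>)) \<partial>P \<mu>) \<le> \<delta> * measure (P \<mu>) (G R)"
  using R
proof (induction R rule: finite_linorder_max_induct)
  case empty
  then show ?case by (simp add: G_def)
next
  case (insert b R)
  interpret prob_space "P \<mu>" using P_space[OF \<mu>] by simp
  have [measurable]: "mass r \<in> borel_measurable (P \<mu>)" if "0 \<le> r" for r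
    using measurable_F_P[OF \<mu> measurable_mass_F[of r]] that by auto
  define B where "B = {\<omega> \<in> space A. mass b \<omega> \<le> \<delta> \<and> (\<forall>r\<in>R. \<not> mass r \<omega> \<le> \<delta>)}"
  have b: "0 \<le> b" "b \<le> t" using insert by auto
  have B_F: "B \<in> sets (F b)"
  proof -
    have [measurable]: "mass r \<in> borel_measurable (F b)" if "r \<in> insert b R" for r
      using insert that by (intro measurable_mass_F) (auto intro: less_imp_le)
    have "{\<omega> \<in> space (F b). mass b \<omega> \<le> \<delta> \<and> (\<forall>r\<in>R. \<not> mass r \<omega> \<le> \<delta>)} \<in> sets (F b)"
      using insert(1) by (intro sets.sets_Collect_conj sets.sets_Collect_finite_All sets.sets_Collect_neg) auto
    then show ?thesis by (simp add: B_def space_F)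
  qed
  then have B_P: "B \<in> events" using sets_filtration P_space[OF \<mu>] by auto
  have G_P: "G R \<in> events"
  proof -
    have "{\<omega> \<in> space (P \<mu>). \<exists>r\<in>R. mass r \<omega> \<le> \<delta>} \<in> events"
      using insert by (intro sets.sets_Collect_finite_Ex) auto
    then show ?thesis using P_space[OF \<mu>] by (simp add: G_def)
  qed
  have G: "G (insert b R) = G R \<union> B" "G R \<inter> B = {}" by (auto simp: G_def B_def)
  have int: "integrable (P \<mu>) (\<lambda>\<omega>. indicator C \<omega> * (1 - exp (- mass t \<omega>)))" if "C \<in> events" for C
    using that t by (intro integrable_const_bound[where B = 1]) (auto split: split_indicator)
  have "(\<integral>\<omega>. indicator (G (insert b R)) \<omega> * (1 - exp (- mass t \<omega>)) \<partial>P \<mu>)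
      = (\<integral>\<omega>. indicator (G R) \<omega> * (1 - exp (- mass t \<omega>)) + indicator B \<omega> * (1 - exp (- mass t \<omega>)) \<partial>P \<mu>)"
    using G(2) unfolding G(1)
    by (intro Bochner_Integration.integral_cong) (auto split: split_indicator)
  also have "\<dots> = (\<integral>\<omega>. indicator (G R) \<omega> * (1 - exp (- mass t \<omega>)) \<partial>P \<mu>)
      + (\<integral>\<omega>. indicator B \<omega> * (1 - exp (- mass t \<omega>)) \<partial>P \<mu>)"
    by (intro Bochner_Integration.integral_add int G_P B_P)
  also have "\<dots> \<le> \<delta> * prob (G R) + \<delta> * prob B"
    using insert by (intro add_mono absorption_step[OF \<beta> \<mu> b B_F]) (auto simp: B_def)
  also have "\<dots> = \<delta> * prob (G (insert b R))"
    unfolding G(1) using G_P B_P G(2) by (subst finite_measure_Union) (auto simp: algebra_simps)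
  finally show ?case .
qed

text \<open>If the mass vanishes at some s < t, right continuity makes it smaller than each 1/(m+1)
  at rational times between s and t. The path then lies in \<open>K\<close>, an event that involves
  only rational times and so is measurable. By the maximal inequality the integral of 1 - exp(- mass
  at t) over \<open>K\<close> is at most 1/(m+1) for every m, so the mass at t vanishes almost
  surely on \<open>K\<close>.\<close>

lemma AE_absorption_at:
  assumes \<beta>: "0 < \<beta>" and \<mu>: "\<mu> \<in> finite_measures" and t: "0 < t"
  shows "AE \<omega> in P \<mu>. (\<exists>s\<in>{0..<t}. mass s \<omega> = 0) \<longrightarrow> mass t \<omega> = 0"
proof -
  interpret prob_space "P \<mu>" using P_space[OF \<mu>] by simp
  define D where "D = {r \<in> \<rat>. 0 \<le> r \<and> r < t}"
  have D: "countable D" "D \<noteq> {}" using t countable_subset[OF _ countable_rat, of D] by (auto simp: D_def)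
  \<comment> \<open>Finite sets increasing to the rationals in [0, t), so that
    \<open>absorption_finite\<close> applies to each.\<close>
  define R where "R n = from_nat_into D ` {..<n}" for n
  have R: "finite (R n)" "R n \<subseteq> D" "(\<Union>n. R n) = D" "incseq R" for n
  proof -
    show "R n \<subseteq> D" using from_nat_into[OF D(2)] by (auto simp: R_def)
    have "(\<Union>n. R n) = range (from_nat_into D)" unfolding R_def by auto
    then show "(\<Union>n. R n) = D" using range_from_nat_into[OF D(2,1)] by simp
    show "incseq R" unfolding R_def by (intro incseq_SucI) auto
  qed (simp add: R_def)
  define G where "G n \<delta> = {\<omega> \<in> space A. \<exists>r\<in>R n. mass r \<omega> \<le> \<delta>}" for n \<delta>
  have [measurable]: "mass r \<in> borel_measurable (P \<mu>)" if "0 \<le> r" for r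
    using measurable_F_P[OF \<mu> measurable_mass_F[of r]] that by auto
  have R_ge: "0 \<le> r" "r \<le> t" if "r \<in> R n" for r n using R(2)[of n] that by (auto simp: D_def)
  have G_P [measurable]: "G n \<delta> \<in> events" for n \<delta>
  proof -
    have "{\<omega> \<in> space (P \<mu>). \<exists>r\<in>R n. mass r \<omega> \<le> \<delta>} \<in> events"
      using R_ge R(1) by (intro sets.sets_Collect_finite_Ex) auto
    then show ?thesis using P_space[OF \<mu>] by (simp add: G_def)
  qed
  let ?g = "\<lambda>\<omega>. 1 - exp (- mass t \<omega>)"
  have mt [measurable]: "mass t \<in> borel_measurable (P \<mu>)" using t by simp
  have g_int: "integrable (P \<mu>) (\<lambda>\<omega>. indicator C \<omega> * ?g \<omega>)" if "C \<in> events" for C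
    using that t by (intro integrable_const_bound[where B = 1]) (auto split: split_indicator)
  have G_le: "(\<integral>\<omega>\<in>(\<Union>n. G n \<delta>). ?g \<omega> \<partial>P \<mu>) \<le> \<delta>" if \<delta>: "0 \<le> \<delta>" for \<delta>
  proof (rule LIMSEQ_le_const2)
    show "(\<lambda>n. \<integral>\<omega>\<in>G n \<delta>. ?g \<omega> \<partial>P \<mu>) \<longlonglongrightarrow> (\<integral>\<omega>\<in>(\<Union>n. G n \<delta>). ?g \<omega> \<partial>P \<mu>)"
    proof (rule set_integral_cont_up)
      show "incseq (\<lambda>n. G n \<delta>)" using R(4) by (fastforce simp: incseq_def G_def)
      show "set_integrable (P \<mu>) (\<Union>n. G n \<delta>) ?g"
        unfolding set_integrable_def real_scaleR_def by (intro g_int) measurable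
    qed simp
    have "(\<integral>\<omega>\<in>G n \<delta>. ?g \<omega> \<partial>P \<mu>) \<le> \<delta>" for n
    proof -
      have "(\<integral>\<omega>\<in>G n \<delta>. ?g \<omega> \<partial>P \<mu>) \<le> \<delta> * prob (G n \<delta>)"
        unfolding set_lebesgue_integral_def real_scaleR_def G_def
        using R_ge[of _ n] t by (intro absorption_finite[OF \<beta> \<mu> R(1)]) auto
      also have "\<dots> \<le> \<delta> * 1" using \<delta> by (intro mult_left_mono) auto
      finally show ?thesis by simp
    qed
    then show "\<exists>N. \<forall>n\<ge>N. (\<integral>\<omega>\<in>G n \<delta>. ?g \<omega> \<partial>P \<mu>) \<le> \<delta>" by blast
  qed
  define K where "K = (\<Inter>m. \<Union>n. G n (1 / real (Suc m)))"
  have K_P [measurable]: "K \<in> events" unfolding K_def by measurable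
  have K_le: "(\<integral>\<omega>. indicator K \<omega> * ?g \<omega> \<partial>P \<mu>) \<le> 1 / real (Suc m)" for m
  proof -
    have "(\<integral>\<omega>. indicator K \<omega> * ?g \<omega> \<partial>P \<mu>) \<le> (\<integral>\<omega>\<in>(\<Union>n. G n (1 / real (Suc m))). ?g \<omega> \<partial>P \<mu>)"
      unfolding set_lebesgue_integral_def real_scaleR_def
      by (intro integral_mono g_int K_P mult_right_mono) (auto simp: K_def split: split_indicator)
    also have "\<dots> \<le> 1 / real (Suc m)" by (rule G_le) simp
    finally show ?thesis .
  qed
  have "(\<integral>\<omega>. indicator K \<omega> * ?g \<omega> \<partial>P \<mu>) \<le> 0"
    by (rule LIMSEQ_le_const[OF LIMSEQ_Suc[OF lim_1_over_n]]) (use K_le in auto)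
  moreover have "0 \<le> (\<integral>\<omega>. indicator K \<omega> * ?g \<omega> \<partial>P \<mu>)" by (intro Bochner_Integration.integral_nonneg) auto
  ultimately have "(\<integral>\<omega>. indicator K \<omega> * ?g \<omega> \<partial>P \<mu>) = 0" by simp
  then have "AE \<omega> in P \<mu>. indicator K \<omega> * ?g \<omega> = 0"
    by (subst (asm) integral_nonneg_eq_0_iff_AE[OF g_int[OF K_P]]) auto
  moreover have "AE \<omega> in P \<mu>. \<omega> \<in> space A"
    using P_space[OF \<mu>] by (intro AE_I2) auto
  ultimately show ?thesis
  proof eventually_elim
    case (elim \<omega>)
    show ?case
    proof safe
      fix s assume s: "s \<in> {0..<t}" "mass s \<omega> = 0"
      have "\<omega> \<in> (\<Union>n. G n (1 / real (Suc m)))" for m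
      proof -
        have "\<forall>\<^sub>F u in at_right s. mass u \<omega> < 1 / real (Suc m)"
          using cadlag_mass_right_continuous[OF cadlag_paths[OF elim(2)], of s] s
          by (intro order_tendstoD(2)[of _ "mass s \<omega>"]) auto
        then obtain u where u: "s < u" "\<And>v. s < v \<Longrightarrow> v < u \<Longrightarrow> mass v \<omega> < 1 / real (Suc m)"
          unfolding eventually_at_right_field by blast
        obtain q where q: "q \<in> \<rat>" "s < q" "q < min u t"
          using Rats_dense_in_real[of s "min u t"] u(1) s(1) by auto
        then have "q \<in> D" using s by (auto simp: D_def)
        then obtain n where "q \<in> R n" using R(3) by blast
        moreover have "mass q \<omega> \<le> 1 / real (Suc m)" using u(2)[of q] q by auto
        ultimately show ?thesis using elim(2) by (auto simp: G_def)
      qed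
      then have "\<omega> \<in> K" by (auto simp: K_def)
      then show "mass t \<omega> = 0" using elim(1) by simp
    qed
  qed
qed

text \<open>One null set has to serve for all pairs of times, so \<open>AE_absorption_at\<close> is
  used only at the positive rationals. If the mass vanished at s and were positive at a later t,
  right continuity would keep it positive at some rational time after t.\<close>

lemma AE_absorption:
  assumes \<beta>: "0 < \<beta>" and \<mu>: "\<mu> \<in> finite_measures"
  shows "AE \<omega> in P \<mu>. \<forall>s t. 0 \<le> s \<longrightarrow> s < t \<longrightarrow> mass s \<omega> = 0 \<longrightarrow> mass t \<omega> = 0"
proof -
  have "countable {t \<in> \<rat>. 0 < (t :: real)}"
    using countable_rat by (rule countable_subset[rotated]) auto
  then have "AE \<omega> in P \<mu>. \<forall>t\<in>{t \<in> \<rat>. 0 < t}. (\<exists>s\<in>{0..<t}. mass s \<omega> = 0) \<longrightarrow> mass t \<omega> = 0"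
    using AE_absorption_at[OF \<beta> \<mu>] by (simp only: AE_ball_countable mem_Collect_eq) blast
  moreover have "AE \<omega> in P \<mu>. \<omega> \<in> space A"
    using P_space[OF \<mu>] by (intro AE_I2) auto
  ultimately show ?thesis
  proof eventually_elim
    case (elim \<omega>)
    show ?case
    proof (intro allI impI, rule ccontr)
      fix s t assume st: "0 \<le> s" "s < t" "mass s \<omega> = 0" "mass t \<omega> \<noteq> 0"
      then have "0 < mass t \<omega>" by (simp add: zero_less_measure_iff)
      then have "\<forall>\<^sub>F u in at_right t. 0 < mass u \<omega>"
        using cadlag_mass_right_continuous[OF cadlag_paths[OF elim(2)], of t] st
        by (intro order_tendstoD(1)[of _ "mass t \<omega>"]) auto
      then obtain u where u: "t < u" "\<And>v. t < v \<Longrightarrow> v < u \<Longrightarrow> 0 < mass v \<omega>"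
        unfolding eventually_at_right_field by blast
      obtain q where q: "q \<in> \<rat>" "t < q" "q < u"
        using Rats_dense_in_real[OF u(1)] by auto
      then have "mass q \<omega> = 0" using elim(1) st by force
      then show False using u(2)[of q] q by simp
    qed
  qed
qed

end

section \<open>Occupation integrals and the local time after extinction\<close>

section \<open>The total local time\<close>

text \<open>This links the Bochner integrals of \<open>log_laplace\<close> with the nonnegative
  integrals of \<open>local_time\<close>. Boundedness of the mass gives integrability, without which
  a Bochner integral would be 0 by default. Continuity of \<open>f\<close> makes the inner integral
  right continuous in time, hence measurable.\<close>

lemma cadlag_time_integral:
  fixes f :: "real \<Rightarrow> real"
  assumes w: "cadlag w" and f: "continuous_on UNIV f" "bounded (range f)" "\<And>x. 0 \<le> f x"
  shows "(\<integral>\<^sup>+s\<in>{0..t}. (\<integral>\<^sup>+x. ennreal (f x) \<partial>w s) \<partial>lborel) = ennreal (LBINT s:{0..t}. \<integral>x. f x \<partial>w s)"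
proof -
  obtain K where K: "\<And>x. f x \<le> K"
    using f(2) by (auto simp: bounded_iff abs_le_iff)
  obtain C where C: "\<And>s. s \<in> {0..t} \<Longrightarrow> measure (w s) UNIV \<le> C"
    using cadlag_mass_bounded[OF w, of t] by blast
  have [measurable]: "f \<in> borel_measurable borel" using f(1) by (rule borel_measurable_continuous_onI)
  have K0: "0 \<le> K" using f(3)[of 0] K[of 0] by linarith
  have int: "integrable (w s) f" if "0 \<le> s" for s
  proof -
    interpret finite_measure "w s" using finite_measuresD(1)[OF cadlag_finite_measures[OF w that]] .
    have "f \<in> borel_measurable (w s)"
      using finite_measuresD(2)[OF cadlag_finite_measures[OF w that]] by simp
    then show ?thesis using f(3) K by (intro integrable_const_bound[where B = K]) auto
  qed
  have bound: "0 \<le> (\<integral>x. f x \<partial>w s)" "(\<integral>x. f x \<partial>w s) \<le> K * C" if "s \<in> {0..t}" for s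
  proof -
    have s: "0 \<le> s" using that by simp
    interpret finite_measure "w s" using finite_measuresD(1)[OF cadlag_finite_measures[OF w s]] .
    show "0 \<le> (\<integral>x. f x \<partial>w s)" using f(3) by (intro Bochner_Integration.integral_nonneg)
    have "(\<integral>x. f x \<partial>w s) \<le> (\<integral>x. K \<partial>w s)" using int[OF s] K by (intro integral_mono) auto
    also have "\<dots> = K * measure (w s) UNIV"
      using finite_measuresD(3)[OF cadlag_finite_measures[OF w s]] by simp
    also have "\<dots> \<le> K * C" using C[OF that] K0 by (rule mult_left_mono)
    finally show "(\<integral>x. f x \<partial>w s) \<le> K * C" .
  qed
  let ?g = "\<lambda>s. indicator {0..} s * (\<integral>x. f x \<partial>w s)"
  have g_meas [measurable]: "?g \<in> borel_measurable borel"
    by (intro borel_measurable_right_continuous cadlag_integral_right_continuous w f(1,2))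
  have eq: "indicator {0..t} s * (\<integral>x. f x \<partial>w s) = indicator {0..t} s * ?g s" for s
    by (auto split: split_indicator)
  have "integrable lborel (\<lambda>s. indicator {0..t} s * ?g s)"
  proof (rule Bochner_Integration.integrable_bound)
    show "integrable lborel (\<lambda>s. indicator {0..t} s * (K * C))"
      by (intro integrable_mult_left integrable_real_indicator) (auto simp: emeasure_lborel_Icc_eq)
    show "AE s in lborel. norm (indicator {0..t} s * ?g s) \<le> norm (indicator {0..t} s * (K * C))"
    proof (rule AE_I2)
      fix s
      show "norm (indicator {0..t} s * ?g s) \<le> norm (indicator {0..t} s * (K * C))"
        using bound[of s] by (cases "s \<in> {0..t}") auto
    qed
  qed measurable
  then have set_int: "integrable lborel (\<lambda>s. indicator {0..t} s * (\<integral>x. f x \<partial>w s))"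
    by (simp only: eq)
  have "(\<integral>\<^sup>+s\<in>{0..t}. (\<integral>\<^sup>+x. ennreal (f x) \<partial>w s) \<partial>lborel)
      = (\<integral>\<^sup>+s. ennreal (indicator {0..t} s * (\<integral>x. f x \<partial>w s)) \<partial>lborel)"
    using int f(3) by (intro nn_integral_cong) (auto simp: nn_integral_eq_integral split: split_indicator)
  also have "\<dots> = ennreal (\<integral>s. indicator {0..t} s * (\<integral>x. f x \<partial>w s) \<partial>lborel)"
    using bound by (intro nn_integral_eq_integral set_int) (auto split: split_indicator)
  finally show ?thesis by (simp add: set_lebesgue_integral_def)
qed

text \<open>Applied to \<open>f\<close>, the occupation identity has a finite left side. This makes
  \<open>f x * l x\<close> integrable and lets both sides be read as Bochner integrals.\<close>

lemma occupation_integral: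
  fixes f l :: "real \<Rightarrow> real"
  assumes w: "cadlag w" and f: "continuous_on UNIV f" "bounded (range f)" "\<And>x. 0 \<le> f x"
    and l: "continuous_on UNIV l" "\<And>x. 0 \<le> l x"
    and occ: "\<And>\<phi>. \<phi> \<in> borel_measurable borel \<Longrightarrow>
      (\<integral>\<^sup>+s\<in>{0..t}. (\<integral>\<^sup>+x. \<phi> x \<partial>w s) \<partial>lborel) = (\<integral>\<^sup>+x. \<phi> x * ennreal (l x) \<partial>lborel)"
  shows "integrable lborel (\<lambda>x. f x * l x)"
    and "(LBINT s:{0..t}. \<integral>x. f x \<partial>w s) = (\<integral>x. f x * l x \<partial>lborel)"
proof -
  have [measurable]: "f \<in> borel_measurable borel" "l \<in> borel_measurable borel"
    using f(1) l(1) by (auto intro: borel_measurable_continuous_onI)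
  have "(\<integral>\<^sup>+x. ennreal (f x * l x) \<partial>lborel) = (\<integral>\<^sup>+x. ennreal (f x) * ennreal (l x) \<partial>lborel)"
    using f(3) l(2) by (simp add: ennreal_mult)
  also have "\<dots> = (\<integral>\<^sup>+s\<in>{0..t}. (\<integral>\<^sup>+x. ennreal (f x) \<partial>w s) \<partial>lborel)"
    by (subst occ) auto
  also have "\<dots> = ennreal (LBINT s:{0..t}. \<integral>x. f x \<partial>w s)"
    by (rule cadlag_time_integral[OF w f])
  finally have eq: "(\<integral>\<^sup>+x. ennreal (f x * l x) \<partial>lborel) = ennreal (LBINT s:{0..t}. \<integral>x. f x \<partial>w s)" .
  have nonneg: "0 \<le> (LBINT s:{0..t}. \<integral>x. f x \<partial>w s)"
    unfolding set_lebesgue_integral_def using f(3) by (intro Bochner_Integration.integral_nonneg) auto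
  show int: "integrable lborel (\<lambda>x. f x * l x)"
    using f(3) l(2) eq by (intro integrableI_nonneg) auto
  have "ennreal (\<integral>x. f x * l x \<partial>lborel) = ennreal (LBINT s:{0..t}. \<integral>x. f x \<partial>w s)"
    unfolding eq[symmetric] using f(3) l(2) int by (intro nn_integral_eq_integral[symmetric]) auto
  then show "(LBINT s:{0..t}. \<integral>x. f x \<partial>w s) = (\<integral>x. f x * l x \<partial>lborel)"
    using nonneg f(3) l(2) by (subst (asm) ennreal_inj) auto
qed

text \<open>Testing with indicators gives equality almost everywhere. The set where two continuous
  functions differ is open, and an open null set is empty.\<close>

lemma continuous_densities_eq:
  fixes f g :: "real \<Rightarrow> real"
  assumes f: "continuous_on UNIV f" "\<And>x. 0 \<le> f x" and g: "continuous_on UNIV g" "\<And>x. 0 \<le> g x"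
    and eq: "\<And>\<phi>. \<phi> \<in> borel_measurable borel \<Longrightarrow>
      (\<integral>\<^sup>+x. \<phi> x * ennreal (f x) \<partial>lborel) = (\<integral>\<^sup>+x. \<phi> x * ennreal (g x) \<partial>lborel)"
  shows "f = g"
proof -
  have [measurable]: "f \<in> borel_measurable borel" "g \<in> borel_measurable borel"
    using f(1) g(1) by (auto intro: borel_measurable_continuous_onI)
  have "density lborel (\<lambda>x. ennreal (f x)) = density lborel (\<lambda>x. ennreal (g x))"
  proof (rule measure_eqI)
    fix S assume "S \<in> sets (density lborel (\<lambda>x. ennreal (f x)))"
    then have [measurable]: "S \<in> sets borel" by simp
    show "emeasure (density lborel (\<lambda>x. ennreal (f x))) S = emeasure (density lborel (\<lambda>x. ennreal (g x))) S"
      using eq[of "indicator S"] by (simp add: emeasure_density mult.commute)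
  qed simp
  then have "AE x in lborel. ennreal (f x) = ennreal (g x)"
    by (intro sigma_finite_measure.density_unique[OF sigma_finite_lborel]) auto
  then have "AE x in lborel. f x = g x"
    using f(2) g(2) by (simp add: ennreal_inj)
  then have null: "{x. f x \<noteq> g x} \<in> null_sets lborel"
    by (subst (asm) AE_iff_null) auto
  have "open {x. f x \<noteq> g x}"
    by (intro open_Collect_neq f(1) g(1))
  moreover have "negligible {x. f x \<noteq> g x}"
    using null_sets_completionI[OF null] by (simp add: negligible_iff_null_sets)
  ultimately have "{x. f x \<noteq> g x} = {}" using open_not_negligible by blast
  then show ?thesis by auto
qed

lemma null_mass_integral:
  assumes "\<mu> \<in> finite_measures" "measure \<mu> UNIV = 0"
  shows "AE x in \<mu>. Q x" "(\<integral>x. f x \<partial>\<mu>) = (0 :: real)" "(\<integral>\<^sup>+x. \<phi> x \<partial>\<mu>) = 0"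
proof -
  interpret finite_measure \<mu> using finite_measuresD(1)[OF assms(1)] .
  have "emeasure \<mu> (space \<mu>) = 0"
    using assms finite_measuresD(3)[OF assms(1)] by (simp add: emeasure_eq_measure)
  then show AE: "AE x in \<mu>. Q x" for Q by (rule emeasure_0_AE)
  show "(\<integral>x. f x \<partial>\<mu>) = 0" using AE by (rule integral_eq_zero_AE)
  show "(\<integral>\<^sup>+x. \<phi> x \<partial>\<mu>) = 0" using nn_integral_cong_AE[OF AE[of "\<lambda>x. \<phi> x = 0"]] by simp
qed

text \<open>After the extinction time the mass is zero, so the occupation integrals stop growing,
  and continuity of the densities upgrades this to equality at every point x. Integer times are used
  so that later limits run along a sequence.\<close>

lemma total_local_time_eventually:
  fixes X :: "real \<Rightarrow> 'w \<Rightarrow> real measure"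
  assumes cadlag: "cadlag (\<lambda>t. X t \<omega>)"
    and L_cont: "\<And>t. 0 \<le> t \<Longrightarrow> continuous_on UNIV (\<lambda>x. L t x \<omega>)"
    and L_nonneg: "\<And>t x. 0 \<le> t \<Longrightarrow> 0 \<le> L t x \<omega>"
    and occ: "\<And>t \<phi>. 0 \<le> t \<Longrightarrow> \<phi> \<in> borel_measurable borel \<Longrightarrow>
      (\<integral>\<^sup>+s\<in>{0..t}. (\<integral>\<^sup>+x. \<phi> x \<partial>X s \<omega>) \<partial>lborel) = (\<integral>\<^sup>+x. \<phi> x * ennreal (L t x \<omega>) \<partial>lborel)"
    and extinct: "0 \<le> u" "measure (X u \<omega>) UNIV = 0"
    and absorb: "\<And>s t. 0 \<le> s \<Longrightarrow> s < t \<Longrightarrow> measure (X s \<omega>) UNIV = 0 \<Longrightarrow> measure (X t \<omega>) UNIV = 0"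
  shows "\<exists>N. \<forall>n\<ge>N. measure (X (real n) \<omega>) UNIV = 0 \<and> (\<forall>x. L (real n) x \<omega> = total_local_time X L x \<omega>)"
proof -
  define z where "z = extinction_time X \<omega>"
  have "0 \<le> z" unfolding z_def extinction_time_def by (rule Inf_greatest) auto
  moreover have "z \<le> ereal u"
    unfolding z_def extinction_time_def using extinct by (intro Inf_lower) auto
  ultimately obtain \<zeta> where \<zeta>: "z = ereal \<zeta>" "0 \<le> \<zeta>" by (cases z) auto
  \<comment> \<open>Beyond the infimum there is an earlier time s of zero mass, whether or not the
    infimum is attained, and absorption carries the zero from s to t.\<close>
  have zero: "measure (X t \<omega>) UNIV = 0" if "\<zeta> < t" for t
  proof -
    have "Inf {ereal t |t. 0 \<le> t \<and> measure (X t \<omega>) UNIV = 0} < ereal t"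
      using that \<zeta>(1) by (simp add: z_def extinction_time_def)
    then obtain s where "0 \<le> s" "measure (X s \<omega>) UNIV = 0" "s < t"
      unfolding Inf_less_iff by auto
    then show ?thesis using absorb by blast
  qed
  have L_eq: "(\<lambda>x. L t x \<omega>) = (\<lambda>x. L \<zeta> x \<omega>)" if "\<zeta> < t" for t
  proof (rule continuous_densities_eq)
    have t: "0 \<le> t" using that \<zeta>(2) by simp
    show "continuous_on UNIV (\<lambda>x. L t x \<omega>)" "continuous_on UNIV (\<lambda>x. L \<zeta> x \<omega>)"
      "0 \<le> L t x \<omega>" "0 \<le> L \<zeta> x \<omega>" for x
      using t \<zeta>(2) L_cont L_nonneg by auto
    fix \<phi> :: "real \<Rightarrow> ennreal" assume \<phi>: "\<phi> \<in> borel_measurable borel"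
    have "(\<integral>\<^sup>+x. \<phi> x \<partial>X s \<omega>) * indicator {0..t} s = (\<integral>\<^sup>+x. \<phi> x \<partial>X s \<omega>) * indicator {0..\<zeta>} s" for s
    proof (cases "\<zeta> < s")
      case True
      have "X s \<omega> \<in> finite_measures" using cadlag_finite_measures[OF cadlag, of s] True \<zeta>(2) by simp
      then show ?thesis using null_mass_integral(3)[OF _ zero[OF True]] by simp
    qed (use that in \<open>auto split: split_indicator\<close>)
    then show "(\<integral>\<^sup>+x. \<phi> x * ennreal (L t x \<omega>) \<partial>lborel) = (\<integral>\<^sup>+x. \<phi> x * ennreal (L \<zeta> x \<omega>) \<partial>lborel)"
      using occ[OF t \<phi>] occ[OF \<zeta>(2) \<phi>] by simp
  qed
  obtain N :: nat where N: "\<zeta> < real N" using reals_Archimedean2 by blast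
  show ?thesis
  proof (intro exI[of _ N] allI impI conjI)
    fix n x assume "N \<le> n"
    then have n: "\<zeta> < real n" using N by simp
    show "measure (X (real n) \<omega>) UNIV = 0" by (rule zero[OF n])
    show "L (real n) x \<omega> = total_local_time X L x \<omega>"
      using fun_cong[OF L_eq[OF n], of x] \<zeta>(1) by (simp add: total_local_time_def z_def[symmetric])
  qed
qed

lemma return_finite_measures: "return borel x \<in> finite_measures"
  using prob_space.finite_measure[OF prob_space_return[of x borel]] by (simp add: finite_measures_def)

context stable_super_brownian_motion
begin

text \<open>Collects the path properties for the two limits that follow. The quantifiers over
  \<open>f\<close> and \<open>g\<close> stand inside \<open>AE\<close>, so a single null set serves
  every source and every profile.\<close>

lemma AE_total_local_time:
  assumes \<beta>: "0 < \<beta>" and \<mu>: "\<mu> \<in> finite_measures" and L: "local_time (P \<mu>) X L"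
  shows "AE \<omega> in P \<mu>. continuous_on UNIV (\<lambda>x. total_local_time X L x \<omega>) \<and>
    (\<forall>x. 0 \<le> total_local_time X L x \<omega>) \<and>
    integrable lborel (\<lambda>x. total_local_time X L x \<omega>) \<and>
    (\<forall>\<^sub>F n in sequentially. L (real n) 0 \<omega> = total_local_time X L 0 \<omega>) \<and>
    (\<forall>f. continuous_on UNIV f \<longrightarrow> bounded (range f) \<longrightarrow> (\<forall>x. 0 \<le> f x) \<longrightarrow>
      (\<forall>\<^sub>F n in sequentially. (LBINT s:{0..real n}. \<integral>x. f x \<partial>X s \<omega>)
        = (\<integral>x. f x * total_local_time X L x \<omega> \<partial>lborel))) \<and>
    (\<forall>g :: real \<Rightarrow> real. \<forall>\<^sub>F n in sequentially. (\<integral>x. g x \<partial>X (real n) \<omega>) = 0)"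
proof -
  have "AE \<omega> in P \<mu>. \<omega> \<in> space A" using P_space[OF \<mu>] by (intro AE_I2) auto
  moreover have "AE \<omega> in P \<mu>.
        continuous_on ({0..} \<times> UNIV) (\<lambda>(t, x). L t x \<omega>) \<and>
        (\<forall>t\<ge>0. \<forall>x. 0 \<le> L t x \<omega>) \<and>
        (\<forall>t\<ge>0. \<forall>\<phi> \<in> borel_measurable borel.
           (\<integral>\<^sup>+s\<in>{0..t}. (\<integral>\<^sup>+x. \<phi> x \<partial>X s \<omega>) \<partial>lborel)
             = (\<integral>\<^sup>+x. \<phi> x * ennreal (L t x \<omega>) \<partial>lborel))"
    using L unfolding local_time_def by blast
  ultimately show ?thesis
    using AE_extinct[OF \<beta> \<mu>] AE_absorption[OF \<beta> \<mu>]
  proof eventually_elim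
    case (elim \<omega>)
    note cadlag = cadlag_paths[OF elim(1)]
    have L_cont: "continuous_on UNIV (\<lambda>x. L t x \<omega>)" if "0 \<le> t" for t
    proof -
      have "continuous_on UNIV (Pair t :: real \<Rightarrow> real \<times> real)" by (intro continuous_intros)
      from continuous_on_compose2[OF conjunct1[OF elim(2)] this] that show ?thesis by auto
    qed
    have L_nonneg: "0 \<le> L t x \<omega>" if "0 \<le> t" for t x using elim(2) that by blast
    have occ: "(\<integral>\<^sup>+s\<in>{0..t}. (\<integral>\<^sup>+x. \<phi> x \<partial>X s \<omega>) \<partial>lborel) = (\<integral>\<^sup>+x. \<phi> x * ennreal (L t x \<omega>) \<partial>lborel)"
      if "0 \<le> t" "\<phi> \<in> borel_measurable borel" for t \<phi>
      using elim(2) that by blast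
    obtain m :: nat where m: "mass (real m) \<omega> = 0" using elim(3) by blast
    obtain N where N: "\<And>n. N \<le> n \<Longrightarrow> mass (real n) \<omega> = 0"
      "\<And>n x. N \<le> n \<Longrightarrow> L (real n) x \<omega> = total_local_time X L x \<omega>"
      using total_local_time_eventually[where X = X and L = L and \<omega> = \<omega>, OF cadlag L_cont L_nonneg occ of_nat_0_le_iff m] elim(4) by blast
    let ?l = "\<lambda>x. total_local_time X L x \<omega>"
    have l: "(\<lambda>x. L (real n) x \<omega>) = ?l" if "N \<le> n" for n using N(2)[OF that] by auto
    have l_cont: "continuous_on UNIV ?l" using L_cont[of "real N"] by (simp only: l[OF order_refl])
    have l_nonneg: "0 \<le> ?l x" for x using L_nonneg[of "real N" x] N(2)[of N x] by simp
    have l_occ: "(\<integral>\<^sup>+s\<in>{0..real n}. (\<integral>\<^sup>+x. \<phi> x \<partial>X s \<omega>) \<partial>lborel) = (\<integral>\<^sup>+x. \<phi> x * ennreal (?l x) \<partial>lborel)"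
      if "N \<le> n" "\<phi> \<in> borel_measurable borel" for n \<phi>
      using occ[OF _ that(2), of "real n"] N(2)[OF that(1)] by simp
    \<comment> \<open>The test function 1: the total occupation mass is finite, which gives the
      integrability that \<open>source_tendsto\<close> asks for.\<close>
    have int: "integrable lborel (\<lambda>x. 1 * ?l x)"
      by (rule occupation_integral(1)[OF cadlag _ _ _ l_cont l_nonneg l_occ[OF order_refl]]) auto
    show ?case
    proof (intro conjI allI impI)
      show "\<forall>\<^sub>F n in sequentially. L (real n) 0 \<omega> = ?l 0"
        using N(2) unfolding eventually_sequentially by blast
      fix f :: "real \<Rightarrow> real" assume f: "continuous_on UNIV f" "bounded (range f)" "\<forall>x. 0 \<le> f x"
      show "\<forall>\<^sub>F n in sequentially. (LBINT s:{0..real n}. \<integral>x. f x \<partial>X s \<omega>) = (\<integral>x. f x * ?l x \<partial>lborel)"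
        unfolding eventually_sequentially
        using occupation_integral(2)[OF cadlag f(1,2) _ l_cont l_nonneg l_occ] f(3) by blast
    next
      fix g :: "real \<Rightarrow> real"
      have "(\<integral>x. g x \<partial>X (real n) \<omega>) = 0" if "N \<le> n" for n
        using null_mass_integral(2)[OF X_finite_measures[OF elim(1)] N(1)[OF that]] by simp
      then show "\<forall>\<^sub>F n in sequentially. (\<integral>x. g x \<partial>X (real n) \<omega>) = 0"
        unfolding eventually_sequentially by blast
    qed (use l_cont l_nonneg int in auto)
  qed
qed

section \<open>The Laplace transform of the local time at the origin and its stable law\<close>

text \<open>With the stationary solution started from a unit mass at 0, the log-Laplace expectation
  equals exp(- V(0)) at every time n. First n tends to infinity, which leaves the source integrated
  against the total local time; then e tends to 0 by \<open>source_tendsto\<close> and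
  \<open>profile_tendsto\<close>. \<open>S\<close> is a measurable version of the total local time
  at 0.\<close>

lemma laplace_total_local_time:
  assumes \<beta>: "0 < \<beta>" and L: "local_time (P (return borel 0)) X L" and b: "0 < b"
    and S: "S \<in> borel_measurable (P (return borel 0))"
      "AE \<omega> in P (return borel 0). S \<omega> = total_local_time X L 0 \<omega>"
  shows "(\<integral>\<omega>. exp (- (profile_scale \<beta> * (2 / \<beta>) * b powr (- (2 / \<beta>) - 1) * S \<omega>)) \<partial>P (return borel 0))
    = exp (- (profile_scale \<beta> * b powr (- (2 / \<beta>))))"
proof -
  let ?\<mu> = "return borel (0::real)"
  note \<mu> = return_finite_measures[of 0]
  interpret prob_space "P ?\<mu>" using P_space[OF \<mu>] by simp
  define e where "e k = 1 / real (Suc k)" for k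
  have e: "0 < e k" "e k \<le> 1" "e \<longlonglongrightarrow> 0" for k
  proof -
    show "e \<longlonglongrightarrow> 0" unfolding e_def by (rule LIMSEQ_Suc[OF lim_1_over_n])
  qed (auto simp: e_def)
  let ?V = "\<lambda>k. profile \<beta> b (e k)" and ?f = "\<lambda>k. source \<beta> b (e k)"
  let ?l = "\<lambda>\<omega> x. total_local_time X L x \<omega>"
  define G where "G k n \<omega> = exp (- (\<integral>x. ?V k x \<partial>X (real n) \<omega>)
      - (LBINT s:{0..real n}. \<integral>x. ?f k x \<partial>X s \<omega>))" for k n \<omega>
  have G_E: "expectation (G k n) = exp (- ?V k 0)" for k n
  proof -
    have "expectation (G k n) = exp (- (\<integral>x. ?V k x \<partial>?\<mu>))"
      unfolding G_def
      by (intro log_laplace \<mu> bounded_nonneg_borel_profile bounded_nonneg_borel_source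
          mild_solution_profile \<beta> b e) simp
    also have "(\<integral>x. ?V k x \<partial>?\<mu>) = ?V k 0"
      using borel_measurable_continuous_onI[OF profile_continuous[OF \<beta> b e(1)]] by (intro integral_return) auto
    finally show ?thesis .
  qed
  have G_meas [measurable]: "G k n \<in> borel_measurable (P ?\<mu>)" for k n
  proof -
    \<comment> \<open>A function that is not integrable has Bochner integral 0, so a nonzero
      expectation certifies integrability and with it measurability.\<close>
    have "expectation (G k n) \<noteq> 0" using G_E by simp
    then have "integrable (P ?\<mu>) (G k n)" using not_integrable_integral_eq by blast
    then show ?thesis by (rule borel_measurable_integrable)
  qed
  have G_bound: "norm (G k n \<omega>) \<le> 1" for k n \<omega>
  proof -
    have "0 \<le> (\<integral>x. ?V k x \<partial>X (real n) \<omega>)"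
      using profile_bounds(1)[OF \<beta> b e(1)] by (intro Bochner_Integration.integral_nonneg)
    moreover have "0 \<le> (LBINT s:{0..real n}. \<integral>x. ?f k x \<partial>X s \<omega>)"
      unfolding set_lebesgue_integral_def
      using source_nonneg[OF \<beta> b e(1)] by (intro Bochner_Integration.integral_nonneg) auto
    ultimately show ?thesis unfolding G_def by simp
  qed
  \<comment> \<open>Taking the limit of the measurable \<open>G k n\<close> gives a measurable
    version of the exponential of the total local time tested against the source.\<close>
  define H where "H k \<omega> = lim (\<lambda>n. G k n \<omega>)" for k \<omega>
  have H_meas [measurable]: "H k \<in> borel_measurable (P ?\<mu>)" for k
    unfolding H_def by measurable
  have G_lim: "AE \<omega> in P ?\<mu>. \<forall>k. (\<lambda>n. G k n \<omega>) \<longlonglongrightarrow> exp (- (\<integral>x. ?f k x * ?l \<omega> x \<partial>lborel))"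
    using AE_total_local_time[OF \<beta> \<mu> L]
  proof eventually_elim
    case (elim \<omega>)
    show ?case
    proof (rule allI, rule tendsto_eventually)
      fix k
      have "\<forall>\<^sub>F n in sequentially. (LBINT s:{0..real n}. \<integral>x. ?f k x \<partial>X s \<omega>)
          = (\<integral>x. ?f k x * ?l \<omega> x \<partial>lborel)"
        using elim source_continuous[OF \<beta> b e(1)] source_bounded[OF \<beta> b e(1)] source_nonneg[OF \<beta> b e(1)]
        by blast
      moreover have "\<forall>\<^sub>F n in sequentially. (\<integral>x. ?V k x \<partial>X (real n) \<omega>) = 0" using elim by blast
      ultimately show "\<forall>\<^sub>F n in sequentially. G k n \<omega> = exp (- (\<integral>x. ?f k x * ?l \<omega> x \<partial>lborel))"
        by eventually_elim (simp add: G_def)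
    qed
  qed
  have H_eq: "AE \<omega> in P ?\<mu>. \<forall>k. H k \<omega> = exp (- (\<integral>x. ?f k x * ?l \<omega> x \<partial>lborel))"
    using G_lim by eventually_elim (auto simp: H_def intro: limI)
  have H_E: "expectation (H k) = exp (- ?V k 0)" for k
  proof (rule LIMSEQ_unique)
    show "(\<lambda>n. expectation (G k n)) \<longlonglongrightarrow> expectation (H k)"
    proof (rule integral_dominated_convergence[where w = "\<lambda>_. 1"])
      show "AE \<omega> in P ?\<mu>. (\<lambda>n. G k n \<omega>) \<longlonglongrightarrow> H k \<omega>"
        using G_lim H_eq by eventually_elim simp
    qed (use G_bound in auto)
    show "(\<lambda>n. expectation (G k n)) \<longlonglongrightarrow> exp (- ?V k 0)" unfolding G_E by simp
  qed
  let ?c = "profile_scale \<beta> * (2 / \<beta>) * b powr (- (2 / \<beta>) - 1)"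
  have "(\<lambda>k. expectation (H k)) \<longlonglongrightarrow> expectation (\<lambda>\<omega>. exp (- (?c * S \<omega>)))"
  proof (rule integral_dominated_convergence[where w = "\<lambda>_. 1"])
    show "(\<lambda>\<omega>. exp (- (?c * S \<omega>))) \<in> borel_measurable (P ?\<mu>)" using S(1) by measurable
    show "AE \<omega> in P ?\<mu>. (\<lambda>k. H k \<omega>) \<longlonglongrightarrow> exp (- (?c * S \<omega>))"
      using AE_total_local_time[OF \<beta> \<mu> L] H_eq S(2)
    proof eventually_elim
      case (elim \<omega>)
      have "(\<lambda>k. \<integral>x. ?f k x * ?l \<omega> x \<partial>lborel) \<longlonglongrightarrow> ?c * ?l \<omega> 0"
        using elim(1) by (intro source_tendsto \<beta> b e) auto
      then have "(\<lambda>k. exp (- (\<integral>x. ?f k x * ?l \<omega> x \<partial>lborel))) \<longlonglongrightarrow> exp (- (?c * ?l \<omega> 0))"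
        by (intro tendsto_exp tendsto_minus)
      then show ?case using elim(2,3) by simp
    qed
    show "AE \<omega> in P ?\<mu>. norm (H k \<omega>) \<le> 1" for k
      using AE_total_local_time[OF \<beta> \<mu> L] H_eq
    proof eventually_elim
      case (elim \<omega>)
      have "0 \<le> (\<integral>x. ?f k x * ?l \<omega> x \<partial>lborel)"
        using elim(1) source_nonneg[OF \<beta> b e(1)] by (intro Bochner_Integration.integral_nonneg mult_nonneg_nonneg) auto
      then show ?case using elim(2) by simp
    qed
  qed auto
  moreover have "(\<lambda>k. expectation (H k)) \<longlonglongrightarrow> exp (- (profile_scale \<beta> * b powr (- (2 / \<beta>))))"
    unfolding H_E by (intro tendsto_exp tendsto_minus profile_tendsto b e(3))
  ultimately show ?thesis by (rule LIMSEQ_unique)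
qed

end

theorem corollary1p2:
  fixes \<beta> :: real
    and A :: "'w measure"
    and F :: "real \<Rightarrow> 'w measure"
    and P :: "real measure \<Rightarrow> 'w measure"
    and X :: "real \<Rightarrow> 'w \<Rightarrow> real measure"
    and L :: "real \<Rightarrow> real \<Rightarrow> 'w \<Rightarrow> real"
  assumes "0 < \<beta>" and "\<beta> < 1"
    and "stable_super_brownian_motion A F \<beta> P X"
    and "local_time (P (return borel 0)) X L"
  shows "total_local_time X L 0 \<in> borel_measurable (completion (P (return borel 0))) \<and>
         positive_stable (2 / (2 + \<beta>))
           (distr (completion (P (return borel 0))) borel (total_local_time X L 0))"
proof -
  interpret stable_super_brownian_motion A F \<beta> P X by fact
  define M where "M = P (return borel 0)"
  note \<mu> = return_finite_measures[of 0]
  interpret M: prob_space M unfolding M_def using P_space[OF \<mu>] by simp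
  \<comment> \<open>The local time at 0 is eventually constant along integer times, so this limit is
    almost surely the total local time, and it is measurable without completion.\<close>
  define S where "S \<omega> = lim (\<lambda>n. L (real n) 0 \<omega>)" for \<omega>
  have [measurable]: "L (real n) 0 \<in> borel_measurable M" for n
    using assms(4) by (simp add: local_time_def M_def)
  have S_meas [measurable]: "S \<in> borel_measurable M" unfolding S_def by measurable
  note AE_total = AE_total_local_time[OF assms(1) \<mu> assms(4), folded M_def]
  have S_eq: "AE \<omega> in M. S \<omega> = total_local_time X L 0 \<omega>"
    using AE_total by eventually_elim (auto simp: S_def intro!: limI tendsto_eventually)
  have S_nonneg: "AE \<omega> in M. 0 \<le> S \<omega>"
    using AE_total S_eq by eventually_elim simp
  have total_meas: "total_local_time X L 0 \<in> borel_measurable (completion M)"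
  proof (rule measurableI)
    fix B :: "real set" assume B: "B \<in> sets borel"
    \<comment> \<open>In a complete measure space a set that agrees almost everywhere with a
      measurable one is measurable.\<close>
    show "total_local_time X L 0 -` B \<inter> space (completion M) \<in> sets (completion M)"
    proof (rule completion.in_sets_AE)
      show "S -` B \<inter> space (completion M) \<in> sets (completion M)"
        using measurable_sets[OF measurable_completion[OF S_meas] B] .
      show "AE \<omega> in completion M. \<omega> \<in> S -` B \<inter> space (completion M)
          \<longleftrightarrow> \<omega> \<in> total_local_time X L 0 -` B \<inter> space (completion M)"
        using AE_completion[OF S_eq] by eventually_elim simp
    qed simp
  qed simp
  have distr_eq: "distr (completion M) borel (total_local_time X L 0) = distr M borel S"
  proof -
    have "distr (completion M) borel (total_local_time X L 0) = distr (completion M) borel S"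
      using AE_completion[OF S_eq]
      by (intro distr_cong_AE total_meas measurable_completion[OF S_meas]) (auto elim: AE_mp)
    also have "\<dots> = distr M borel S" by (rule distr_completion[OF S_meas])
    finally show ?thesis .
  qed
  let ?a = "profile_scale \<beta>" and ?q = "2 / \<beta>" and ?\<alpha> = "2 / (2 + \<beta>)"
  have a: "0 < ?a" using profile_scale_pos[OF assms(1)] .
  have q: "0 < ?q" using assms(1) by simp
  have \<alpha>: "?\<alpha> = ?q / (?q + 1)" using assms(1) by (simp add: field_simps)
  \<comment> \<open>The constant left after eliminating b between l = a q b^(-q-1) and the exponent
    a b^(-q).\<close>
  define c where "c = ?a * (?a * ?q) powr (- ?\<alpha>)"
  have laplace: "(\<integral>\<omega>. exp (- l * S \<omega>) \<partial>M) = exp (- c * l powr ?\<alpha>)" if l: "0 \<le> l" for l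
  proof (cases "l = 0")
    \<comment> \<open>The value l = 0 corresponds to infinite b and is checked directly.\<close>
    case True
    then show ?thesis by (simp add: M.prob_space)
  next
    case False
    with l have l: "0 < l" by simp
    \<comment> \<open>The solution of a q b^(-q-1) = l, so that
      \<open>laplace_total_local_time\<close> yields the transform at l.\<close>
    define b where "b = (?a * ?q / l) powr (1 / (?q + 1))"
    have pos: "0 < ?a * ?q / l" using a q l by simp
    have b: "0 < b" using pos by (simp only: b_def powr_gt_zero)
    have "b powr (- ?q - 1) = (?a * ?q / l) powr (1 / (?q + 1) * (- ?q - 1))"
      by (simp only: b_def powr_powr)
    also have "1 / (?q + 1) * (- ?q - 1) = - 1"
    proof -
      have "- ?q - 1 = - (?q + 1)" by simp
      moreover have "1 / r * - r = - 1" if "0 < r" for r :: real using that by simp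
      ultimately show ?thesis using q by (metis add_pos_pos zero_less_one)
    qed
    also have "(?a * ?q / l) powr - 1 = inverse (?a * ?q / l)"
      using pos by (simp only: powr_minus powr_one less_imp_le)
    also have "\<dots> = l / (?a * ?q)" by simp
    finally have 1: "?a * ?q * b powr (- ?q - 1) = l" using a q by simp
    have "b powr (- ?q) = (?a * ?q / l) powr (1 / (?q + 1) * (- ?q))"
      by (simp only: b_def powr_powr)
    also have "1 / (?q + 1) * (- ?q) = - ?\<alpha>" unfolding \<alpha> by simp
    also have "(?a * ?q / l) powr (- ?\<alpha>) = (?a * ?q) powr (- ?\<alpha>) * l powr ?\<alpha>"
    proof -
      have "(u / l) powr (- r) = u powr (- r) * l powr r" if "0 < u" for u r
        using that l by (simp add: powr_divide powr_minus_divide)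
      from this[OF mult_pos_pos[OF a q]] show ?thesis .
    qed
    finally have 2: "?a * b powr (- ?q) = c * l powr ?\<alpha>" by (simp add: c_def)
    show ?thesis
      using laplace_total_local_time[OF assms(1,4) b, folded M_def, OF S_meas S_eq]
      unfolding 1 2 by simp
  qed
  have "positive_stable ?\<alpha> (distr M borel S)"
    unfolding positive_stable_def
  proof (intro conjI exI[of _ c] allI impI)
    show "prob_space (distr M borel S)" by (rule M.prob_space_distr) simp
    show "AE x in distr M borel S. 0 \<le> x" using S_nonneg by (subst AE_distr_iff) auto
    show "0 < c" using a q by (simp add: c_def)
    show "(\<integral>x. exp (- l * x) \<partial>distr M borel S) = exp (- c * l powr ?\<alpha>)" if "0 \<le> l" for l
      using laplace[OF that] by (subst integral_distr) auto
  qed (use assms(1,2) in auto)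
  then show ?thesis using total_meas distr_eq unfolding M_def by simp
qed

end
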